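(* Let $J$, $J'$ be matrices in standard form (see context) with $N=N'$ and $m_N=m_N'=\lambda=\lambda'$. If there exists a unital morphism $\mathfrak{A}_J\to\mathfrak{A}_{J'}$, then $$\frac{\langle\alpha\mid v\rangle}{\langle\alpha'\mid v'\rangle}\in\mathbb{Z}\left[\tfrac1\lambda\right].$$
   Context: Standard form: $N\ge1$, $m_1,\dots,m_N$ are nonnegative integers with $m_N>0$ and $\gcd\{i\mid m_i\ne0\}=1$, and $J$ is the $N\times N$ matrix with first column $(m_1,\dots,m_N)^t$, entries $1$ at positions $(i,i+1)$, $1\le i\le N-1$, and $0$ elsewhere. $\lambda$ is its Perron-Frobenius eigenvalue, $\alpha=(1,\lambda^{-1},\dots,\lambda^{-(N-1)})$ satisfies $\alpha J=\lambda\alpha$, and $v$ is the column vector with $Jv=\lambda v$, $v_1=1$; $\langle\alpha\mid v\rangle=\sum_i\alpha_iv_i$. Primed symbols refer to $J'$. $G_J=\bigcup_{n\ge0}J^{-n}\mathbb{Z}^N\subset\mathbb{Q}^N$, ordered by: $g\neq0$ is positive iff $\langle\alpha\mid g\rangle>0$; $[1]=(1,0,\dots,0)^t$. $\mathfrak{A}_J$ is the unital AF-algebra (unique up to isomorphism) with $(K_0(\mathfrak{A}_J),K_0(\mathfrak{A}_J)_+,[1])\cong(G_J,(G_J)_+,[1])$. A morphism is a $*$-homomorphism. *)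

theory Defs
  imports "Jordan_Normal_Form.Spectral_Radius" "HOL-Analysis.Elementary_Topology"
begin

section \<open>Unital C*-algebras, morphisms, AF-algebras\<close>

text \<open>
  Nonzero unital complex C*-algebras as a type class; the algebra is the whole type. The class
  \<^class>\<open>real_normed_algebra_1\<close> supplies the submultiplicative norm, the unit and \<open>norm 1 = 1\<close>
  (automatic in a nonzero unital C*-algebra).
\<close>

class cstar_algebra = real_normed_algebra_1 + banach +
  fixes scaleC :: "complex \<Rightarrow> 'a \<Rightarrow> 'a"
    and adj :: "'a \<Rightarrow> 'a"
  assumes scaleC_add_right: "scaleC c (x + y) = scaleC c x + scaleC c y"
    and scaleC_add_left: "scaleC (c + d) x = scaleC c x + scaleC d x"
    and scaleC_scaleC: "scaleC c (scaleC d x) = scaleC (c * d) x"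
    and scaleC_of_real: "scaleC (complex_of_real r) x = scaleR r x"
    and mult_scaleC_left: "scaleC c x * y = scaleC c (x * y)"
    and mult_scaleC_right: "x * scaleC c y = scaleC c (x * y)"
    and norm_scaleC: "norm (scaleC c x) = cmod c * norm x"
    and adj_add: "adj (x + y) = adj x + adj y"
    and adj_scaleC: "adj (scaleC c x) = scaleC (cnj c) (adj x)"
    and adj_mult: "adj (x * y) = adj y * adj x"
    and adj_adj: "adj (adj x) = x"
    and cstar_identity: "norm (adj x * x) = (norm x)\<^sup>2"

definition star_hom :: "('a::cstar_algebra \<Rightarrow> 'b::cstar_algebra) \<Rightarrow> bool" where
  "star_hom \<phi> \<longleftrightarrow>
     (\<forall>x y. \<phi> (x + y) = \<phi> x + \<phi> y) \<and>
     (\<forall>c x. \<phi> (scaleC c x) = scaleC c (\<phi> x)) \<and>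
     (\<forall>x y. \<phi> (x * y) = \<phi> x * \<phi> y) \<and>
     (\<forall>x. \<phi> (adj x) = adj (\<phi> x))"

definition unital_star_hom :: "('a::cstar_algebra \<Rightarrow> 'b::cstar_algebra) \<Rightarrow> bool" where
  "unital_star_hom \<phi> \<longleftrightarrow> star_hom \<phi> \<and> \<phi> 1 = 1"

definition fin_dim_star_subalgebra :: "'a::cstar_algebra set \<Rightarrow> bool" where
  "fin_dim_star_subalgebra F \<longleftrightarrow>
     (\<exists>S. finite S \<and> F = Modules.module.span scaleC S) \<and>
     (\<forall>x\<in>F. \<forall>y\<in>F. x * y \<in> F) \<and> (\<forall>x\<in>F. adj x \<in> F)"

definition AF_algebra :: "'a::cstar_algebra itself \<Rightarrow> bool" where
  "AF_algebra _ \<longleftrightarrow>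
     (\<exists>F :: nat \<Rightarrow> 'a set. (\<forall>n. fin_dim_star_subalgebra (F n)) \<and> incseq F \<and>
        closure (\<Union>n. F n) = UNIV)"


section \<open>The ordered group K_0 of a unital C*-algebra\<close>

definition adj_mat :: "'a::cstar_algebra mat \<Rightarrow> 'a mat" where
  "adj_mat A = map_mat adj (transpose_mat A)"

definition projections :: "'a::cstar_algebra itself \<Rightarrow> 'a mat set" where
  "projections _ = {p. square_mat p \<and> p * p = p \<and> adj_mat p = p}"

definition mvn_equiv :: "'a::cstar_algebra mat \<Rightarrow> 'a mat \<Rightarrow> bool" where
  "mvn_equiv p q \<longleftrightarrow>
     (\<exists>w \<in> carrier_mat (dim_row q) (dim_row p). adj_mat w * w = p \<and> w * adj_mat w = q)"

definition mat_oplus :: "'a::zero mat \<Rightarrow> 'a mat \<Rightarrow> 'a mat" where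
  "mat_oplus p q =
     four_block_mat p (0\<^sub>m (dim_row p) (dim_col q)) (0\<^sub>m (dim_row q) (dim_col p)) q"

text \<open>
  The Grothendieck group of the semigroup of Murray-von Neumann classes: the pair \<open>(p, q)\<close> stands
  for the formal difference \<open>[p] - [q]\<close>.
\<close>

definition K0_rel :: "'a::cstar_algebra itself \<Rightarrow> (('a mat \<times> 'a mat) \<times> ('a mat \<times> 'a mat)) set" where
  "K0_rel T = {((p, q), (p', q')).
     p \<in> projections T \<and> q \<in> projections T \<and> p' \<in> projections T \<and> q' \<in> projections T \<and>
     (\<exists>r \<in> projections T.
        mvn_equiv (mat_oplus (mat_oplus p q') r) (mat_oplus (mat_oplus p' q) r))}"

definition K0_diff :: "'a::cstar_algebra mat \<Rightarrow> 'a mat \<Rightarrow> ('a mat \<times> 'a mat) set" where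
  "K0_diff p q = K0_rel TYPE('a) `` {(p, q)}"

definition K0 :: "'a::cstar_algebra itself \<Rightarrow> ('a mat \<times> 'a mat) set monoid" where
  "K0 T = \<lparr>
     carrier = (projections T \<times> projections T) // K0_rel T,
     mult = (\<lambda>X Y. \<Union>(p, q)\<in>X. \<Union>(p', q')\<in>Y. K0_diff (mat_oplus p p') (mat_oplus q q')),
     one = K0_diff (0\<^sub>m 1 1) (0\<^sub>m 1 1)\<rparr>"

definition K0_class :: "'a::cstar_algebra mat \<Rightarrow> ('a mat \<times> 'a mat) set" where
  "K0_class p = K0_diff p (0\<^sub>m 1 1)"

definition K0_pos :: "'a::cstar_algebra itself \<Rightarrow> ('a mat \<times> 'a mat) set set" where
  "K0_pos T = K0_class ` projections T"

definition K0_unit :: "'a::cstar_algebra itself \<Rightarrow> ('a mat \<times> 'a mat) set" where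
  "K0_unit _ = K0_class (1\<^sub>m 1)"


section \<open>Matrices in standard form and their dimension groups\<close>

text \<open>
  Only the values \<open>m 1, \<dots>, m N\<close> are relevant. Rows and columns of matrices are indexed from 0, so
  row \<open>i\<close> of the first column of \<open>std_mat N m\<close> carries the entry \<open>m (i + 1)\<close>.
\<close>

definition standard_form :: "nat \<Rightarrow> (nat \<Rightarrow> nat) \<Rightarrow> bool" where
  "standard_form N m \<longleftrightarrow> N \<ge> 1 \<and> m N > 0 \<and> Gcd {i \<in> {1..N}. m i \<noteq> 0} = 1"

definition std_mat :: "nat \<Rightarrow> (nat \<Rightarrow> nat) \<Rightarrow> 'a::semiring_1 mat" where
  "std_mat N m = mat N N (\<lambda>(i, j).
     if j = 0 then of_nat (m (i + 1)) else if j = i + 1 then 1 else 0)"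

definition pf_eigenvalue :: "nat \<Rightarrow> (nat \<Rightarrow> nat) \<Rightarrow> real" where
  "pf_eigenvalue N m = spectral_radius (std_mat N m)"

definition alpha :: "nat \<Rightarrow> (nat \<Rightarrow> nat) \<Rightarrow> real vec" where
  "alpha N m = vec N (\<lambda>i. 1 / pf_eigenvalue N m ^ i)"

definition is_right_pf_vector :: "nat \<Rightarrow> (nat \<Rightarrow> nat) \<Rightarrow> real vec \<Rightarrow> bool" where
  "is_right_pf_vector N m v \<longleftrightarrow>
     v \<in> carrier_vec N \<and> std_mat N m *\<^sub>v v = pf_eigenvalue N m \<cdot>\<^sub>v v \<and> v $ 0 = 1"

text \<open>
  \<open>J\<close> is invertible over the rationals, so \<open>J\<close> to the power \<open>-n\<close> applied to the integer
  vectors is the set of rational \<open>g\<close> that the \<open>n\<close>-th power of \<open>J\<close> maps to an integer vector.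
\<close>

definition G_group :: "nat \<Rightarrow> (nat \<Rightarrow> nat) \<Rightarrow> rat vec monoid" where
  "G_group N m = \<lparr>
     carrier = {g \<in> carrier_vec N. \<exists>n. \<forall>i<N. ((std_mat N m ^\<^sub>m n) *\<^sub>v g) $ i \<in> \<int>},
     mult = (+),
     one = 0\<^sub>v N\<rparr>"

definition G_pos :: "nat \<Rightarrow> (nat \<Rightarrow> nat) \<Rightarrow> rat vec set" where
  "G_pos N m = {g \<in> carrier (G_group N m).
     g = 0\<^sub>v N \<or> scalar_prod (alpha N m) (map_vec real_of_rat g) > 0}"

definition G_unit :: "nat \<Rightarrow> rat vec" where
  "G_unit N = unit_vec N 0"

text \<open>
  The AF-algebra of the matrix is determined only up to isomorphism; the predicate says that a given
  algebra is (a copy of) it.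
\<close>

definition is_AF_algebra_of :: "'a::cstar_algebra itself \<Rightarrow> nat \<Rightarrow> (nat \<Rightarrow> nat) \<Rightarrow> bool" where
  "is_AF_algebra_of T N m \<longleftrightarrow>
     AF_algebra T \<and>
     (\<exists>f \<in> iso (K0 T) (G_group N m). f ` K0_pos T = G_pos N m \<and> f (K0_unit T) = G_unit N)"


section \<open>The ring generated by the integers and a real number\<close>

definition int_adjoin :: "real \<Rightarrow> real set" where
  "int_adjoin x = range (\<lambda>p :: int poly. poly (of_int_poly p) x)"

end

theory Submission
  imports Defs
begin

text \<open>
  Functoriality of \<open>K\<^sub>0\<close> turns the morphism into a positive unital homomorphism \<open>h : G\<^sub>J \<rightarrow> G\<^sub>J\<^sub>'\<close>. The
  trace \<open>g \<mapsto> \<langle>\<alpha>|g\<rangle>\<close> is the only state of \<open>G\<^sub>J\<close>, because it has rational values and elements of trace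
  0 are infinitesimal; hence \<open>h\<close> preserves traces. Since \<open>m\<^sub>N = \<lambda>\<close>, the matrix \<open>J\<close> is unimodular on the
  integer vectors of trace 0, so the elements of \<open>G\<^sub>J\<close> divisible by every power of \<open>\<lambda>\<close> are exactly the
  \<open>\<int>[1/\<lambda>]\<close>-multiples of \<open>v\<close> (if \<open>\<lambda> = 1\<close> then \<open>N = 1\<close>). As \<open>h\<close> preserves this divisibility,
  \<open>h v = c v'\<close> with \<open>c \<in> \<int>[1/\<lambda>]\<close>, and taking traces gives \<open>\<langle>\<alpha>|v\<rangle> = c \<langle>\<alpha>'|v'\<rangle>\<close>.
\<close>

section \<open>Functoriality of the ordered group \<open>K\<^sub>0\<close>\<close>

lemma adj_0 [simp]: "adj (0::'a::cstar_algebra) = 0"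
  using adj_add[of "0::'a" 0] by simp

lemma adj_1 [simp]: "adj (1::'a::cstar_algebra) = 1"
  using adj_mult[of "adj (1::'a)" 1] by (simp add: adj_adj)

lemma adj_sum: "adj (sum f A) = (\<Sum>x\<in>A. adj (f x :: 'a::cstar_algebra))"
  by (induction A rule: infinite_finite_induct) (simp_all add: adj_add)

lemma dim_adj_mat [simp]: "dim_row (adj_mat A) = dim_col A" "dim_col (adj_mat A) = dim_row A"
  by (simp_all add: adj_mat_def)

lemma adj_mat_index [simp]:
  "i < dim_col A \<Longrightarrow> j < dim_row A \<Longrightarrow> adj_mat A $$ (i, j) = adj (A $$ (j, i))"
  by (simp add: adj_mat_def)

lemma adj_mat_adj_mat [simp]: "adj_mat (adj_mat A) = A"
  by (rule eq_matI) (simp_all add: adj_adj)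

lemma adj_mat_carrier [simp]: "A \<in> carrier_mat m n \<Longrightarrow> adj_mat A \<in> carrier_mat n m"
  by auto

lemma adj_mat_zero [simp]: "adj_mat (0\<^sub>m m n) = 0\<^sub>m n m"
  by (rule eq_matI) simp_all

lemma adj_mat_one [simp]: "adj_mat (1\<^sub>m n) = 1\<^sub>m n"
  by (rule eq_matI) simp_all

lemma adj_mat_mult:
  assumes "A \<in> carrier_mat k l" and "B \<in> carrier_mat l n"
  shows "adj_mat (A * B) = adj_mat B * adj_mat A"
  using assms by (intro eq_matI) (simp_all add: scalar_prod_def adj_sum adj_mult)

lemma adj_mat_four_block:
  assumes "A \<in> carrier_mat k m" "B \<in> carrier_mat k n" "C \<in> carrier_mat l m" "D \<in> carrier_mat l n"
  shows "adj_mat (four_block_mat A B C D) =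
    four_block_mat (adj_mat A) (adj_mat C) (adj_mat B) (adj_mat D)"
  using assms by (intro eq_matI) (auto simp: four_block_mat_def Let_def)

section \<open>Projections and Murray-von Neumann equivalence\<close>

lemma projectionsI:
  "p \<in> carrier_mat n n \<Longrightarrow> p * p = p \<Longrightarrow> adj_mat p = p \<Longrightarrow> p \<in> projections T"
  by (auto simp: projections_def)

lemma projectionsE:
  assumes "p \<in> projections T"
  obtains n where "p \<in> carrier_mat n n" "p * p = p" "adj_mat p = p"
  using assms by (auto simp: projections_def)

lemma projection_carrier:
  "p \<in> projections T \<Longrightarrow> p \<in> carrier_mat (dim_row p) (dim_row p)"
  by (erule projectionsE) simp

lemma zero_projection [simp]: "0\<^sub>m n n \<in> projections T"
  by (rule projectionsI[of _ n]) simp_all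

lemma one_projection [simp]: "1\<^sub>m n \<in> projections T"
  by (rule projectionsI[of _ n]) simp_all

lemma mvn_equivI:
  assumes "w \<in> carrier_mat k n" "p \<in> carrier_mat n n" "q \<in> carrier_mat k k"
    "adj_mat w * w = p" "w * adj_mat w = q"
  shows "mvn_equiv p q"
  using assms by (auto simp: mvn_equiv_def)

lemma mvn_equivE:
  assumes "mvn_equiv p q" "p \<in> carrier_mat n n" "q \<in> carrier_mat k k"
  obtains w where "w \<in> carrier_mat k n" "adj_mat w * w = p" "w * adj_mat w = q"
  using assms by (auto simp: mvn_equiv_def)

lemma mvn_equiv_refl:
  assumes "p \<in> projections T"
  shows "mvn_equiv p p"
proof -
  obtain n where "p \<in> carrier_mat n n" "p * p = p" "adj_mat p = p"
    using assms by (rule projectionsE)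
  then show ?thesis by (intro mvn_equivI[of p n n]) simp_all
qed

text \<open>The adjoint of a partial isometry exchanges its source and range projections.\<close>

lemma mvn_equiv_sym:
  assumes "p \<in> projections T" "q \<in> projections T" "mvn_equiv p q"
  shows "mvn_equiv q p"
proof -
  note c = projection_carrier[OF assms(1)] projection_carrier[OF assms(2)]
  obtain w where w: "w \<in> carrier_mat (dim_row q) (dim_row p)" "adj_mat w * w = p" "w * adj_mat w = q"
    by (rule mvn_equivE[OF assms(3) c])
  show ?thesis
    by (rule mvn_equivI[OF adj_mat_carrier[OF w(1)] c(2,1)]) (simp_all only: adj_mat_adj_mat w)
qed

text \<open>The product \<open>x * w\<close> of the partial isometries implements the equivalence.
  The middle projection \<open>q\<close> is rewritten through the other factor, which leaves
  \<open>p * p\<close> on one side and \<open>r * r\<close> on the other.\<close>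

lemma mvn_equiv_trans:
  assumes p: "p \<in> projections T" and q: "q \<in> projections T" and r: "r \<in> projections T"
    and "mvn_equiv p q" "mvn_equiv q r"
  shows "mvn_equiv p r"
proof -
  obtain n where n: "p \<in> carrier_mat n n" "p * p = p" using p by (rule projectionsE)
  obtain k where k: "q \<in> carrier_mat k k" "q * q = q" using q by (rule projectionsE)
  obtain l where l: "r \<in> carrier_mat l l" "r * r = r" using r by (rule projectionsE)
  obtain w where w: "w \<in> carrier_mat k n" "adj_mat w * w = p" "w * adj_mat w = q"
    by (rule mvn_equivE[OF assms(4) n(1) k(1)])
  obtain x where x: "x \<in> carrier_mat l k" "adj_mat x * x = q" "x * adj_mat x = r"
    by (rule mvn_equivE[OF assms(5) k(1) l(1)])
  note w' = adj_mat_carrier[OF w(1)] and x' = adj_mat_carrier[OF x(1)]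
  show ?thesis
  proof (rule mvn_equivI)
    show xw: "x * w \<in> carrier_mat l n" using x(1) w(1) by simp
    have adj: "adj_mat (x * w) = adj_mat w * adj_mat x"
      using x(1) w(1) by (rule adj_mat_mult)
    have "adj_mat w * adj_mat x * (x * w) = adj_mat w * (adj_mat x * (x * w))"
      by (rule assoc_mult_mat[OF w' x' xw])
    also have "adj_mat x * (x * w) = w * adj_mat w * w"
      using assoc_mult_mat[OF x' x(1) w(1)] by (simp add: x(2) w(3))
    also have "\<dots> = w * p"
      using assoc_mult_mat[OF w(1) w' w(1)] by (simp add: w(2))
    also have "adj_mat w * (w * p) = p"
      using assoc_mult_mat[OF w' w(1) n(1)] by (simp add: w(2) n(2))
    finally show "adj_mat (x * w) * (x * w) = p" unfolding adj .
    have "x * w * (adj_mat w * adj_mat x) = x * (w * (adj_mat w * adj_mat x))"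
      by (rule assoc_mult_mat[OF x(1) w(1) mult_carrier_mat[OF w' x']])
    also have "w * (adj_mat w * adj_mat x) = adj_mat x * x * adj_mat x"
      using assoc_mult_mat[OF w(1) w' x'] by (simp add: w(3) x(2))
    also have "\<dots> = adj_mat x * r"
      using assoc_mult_mat[OF x' x(1) x'] by (simp add: x(3))
    also have "x * (adj_mat x * r) = r"
      using assoc_mult_mat[OF x(1) x' l(1)] by (simp add: x(3) l(2))
    finally show "x * w * adj_mat (x * w) = r" unfolding adj .
  qed (fact n(1) l(1))+
qed

section \<open>Block diagonal sums\<close>

lemma mat_oplus_eq:
  "p \<in> carrier_mat k m \<Longrightarrow> q \<in> carrier_mat l n \<Longrightarrow>
    mat_oplus p q = four_block_mat p (0\<^sub>m k n) (0\<^sub>m l m) q"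
  by (auto simp: mat_oplus_def)

lemma mat_oplus_carrier [simp]:
  "p \<in> carrier_mat k m \<Longrightarrow> q \<in> carrier_mat l n \<Longrightarrow> mat_oplus p q \<in> carrier_mat (k + l) (m + n)"
  by (simp add: mat_oplus_def)

lemma adj_mat_oplus: "adj_mat (mat_oplus p q) = mat_oplus (adj_mat p) (adj_mat q)"
  unfolding mat_oplus_def by (subst adj_mat_four_block) auto

lemma mat_oplus_mult:
  fixes p q p' q' :: "'a::semiring_1 mat"
  assumes "p \<in> carrier_mat k m" "q \<in> carrier_mat l n" "p' \<in> carrier_mat m k'" "q' \<in> carrier_mat n l'"
  shows "mat_oplus p q * mat_oplus p' q' = mat_oplus (p * p') (q * q')"
proof -
  have "mat_oplus p q * mat_oplus p' q' =
      four_block_mat (p * p' + 0\<^sub>m k n * 0\<^sub>m n k') (p * 0\<^sub>m m l' + 0\<^sub>m k n * q')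
        (0\<^sub>m l m * p' + q * 0\<^sub>m n k') (0\<^sub>m l m * 0\<^sub>m m l' + q * q')"
    unfolding mat_oplus_eq[OF assms(1,2)] mat_oplus_eq[OF assms(3,4)]
    by (rule mult_four_block_mat[OF assms(1) zero_carrier_mat zero_carrier_mat assms(2)
          assms(3) zero_carrier_mat zero_carrier_mat assms(4)])
  also have "\<dots> = mat_oplus (p * p') (q * q')"
    using assms by (subst mat_oplus_eq[of _ k k' _ l l']) simp_all
  finally show ?thesis .
qed

lemma mat_oplus_assoc: "mat_oplus (mat_oplus p q) r = mat_oplus p (mat_oplus q r)"
  unfolding mat_oplus_def by (rule assoc_four_block_mat[symmetric])

lemma mat_oplus_projection [simp]:
  assumes "p \<in> projections T" "q \<in> projections T"
  shows "mat_oplus p q \<in> projections T"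
proof -
  obtain n where n: "p \<in> carrier_mat n n" "p * p = p" "adj_mat p = p"
    using assms(1) by (rule projectionsE)
  obtain k where k: "q \<in> carrier_mat k k" "q * q = q" "adj_mat q = q"
    using assms(2) by (rule projectionsE)
  show ?thesis
    using n k by (intro projectionsI[of _ "n + k"]) (simp_all add: mat_oplus_mult[of _ n n _ k k _ n _ k] adj_mat_oplus)
qed

lemma mvn_equiv_oplus:
  assumes "p \<in> projections T" "p' \<in> projections T" "q \<in> projections T" "q' \<in> projections T"
    and "mvn_equiv p p'" "mvn_equiv q q'"
  shows "mvn_equiv (mat_oplus p q) (mat_oplus p' q')"
proof -
  define n n' k k' where "n = dim_row p" and "n' = dim_row p'" and "k = dim_row q" and "k' = dim_row q'"
  have c: "p \<in> carrier_mat n n" "p' \<in> carrier_mat n' n'"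
    "q \<in> carrier_mat k k" "q' \<in> carrier_mat k' k'"
    using assms(1-4)[THEN projection_carrier] unfolding n_def n'_def k_def k'_def .
  obtain w where w: "w \<in> carrier_mat n' n" "adj_mat w * w = p" "w * adj_mat w = p'"
    by (rule mvn_equivE[OF assms(5) c(1,2)])
  obtain x where x: "x \<in> carrier_mat k' k" "adj_mat x * x = q" "x * adj_mat x = q'"
    by (rule mvn_equivE[OF assms(6) c(3,4)])
  show ?thesis
  proof (rule mvn_equivI[of "mat_oplus w x" "n' + k'" "n + k"])
    show "adj_mat (mat_oplus w x) * mat_oplus w x = mat_oplus p q"
      unfolding adj_mat_oplus using w x by (subst mat_oplus_mult) auto
    show "mat_oplus w x * adj_mat (mat_oplus w x) = mat_oplus p' q'"
      unfolding adj_mat_oplus using w x by (subst mat_oplus_mult) auto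
  qed (use c w x in simp_all)
qed

text \<open>The blocks are exchanged by the off-diagonal matrix with corners \<open>q\<close> and
  \<open>p\<close>; as these are projections, it is a partial isometry with exactly the required
  source and range.\<close>

lemma mvn_equiv_oplus_commute:
  fixes p q :: "'a::cstar_algebra mat"
  assumes "p \<in> projections T" "q \<in> projections T"
  shows "mvn_equiv (mat_oplus p q) (mat_oplus q p)"
proof -
  obtain n where n: "p \<in> carrier_mat n n" "p * p = p" "adj_mat p = p"
    using assms(1) by (rule projectionsE)
  obtain k where k: "q \<in> carrier_mat k k" "q * q = q" "adj_mat q = q"
    using assms(2) by (rule projectionsE)
  define w where "w = four_block_mat (0\<^sub>m k n) q p (0\<^sub>m n k)"
  have adj: "adj_mat w = four_block_mat (0\<^sub>m n k) p q (0\<^sub>m k n)"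
    unfolding w_def using n k by (subst adj_mat_four_block[of _ k n _ k _ n]) simp_all
  show ?thesis
  proof (rule mvn_equivI[of w "k + n" "n + k"])
    show "adj_mat w * w = mat_oplus p q"
      unfolding adj unfolding w_def mat_oplus_eq[OF n(1) k(1)]
      by (subst mult_four_block_mat[of _ n k _ n _ k _ _ n _ k]) (use n k in simp_all)
    show "w * adj_mat w = mat_oplus q p"
      unfolding adj unfolding w_def mat_oplus_eq[OF k(1) n(1)]
      by (subst mult_four_block_mat[of _ k n _ k _ n _ _ k _ n]) (use n k in simp_all)
  qed (use n k in \<open>simp_all add: w_def\<close>)
qed

\<comment> \<open>The quotient is partial because only projections have a class. On classes the
  block sum is associative and commutative, so a type of classes lets sums be rearranged by
  \<open>ac_simps\<close>.\<close>
quotient_type (overloaded) 'a mvn_class = "'a::cstar_algebra mat" / partial: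
  "\<lambda>p q. p \<in> projections TYPE('a) \<and> q \<in> projections TYPE('a) \<and> mvn_equiv p q"
  morphisms rep_mvn_class mvn_class
proof (rule part_equivpI)
  show "\<exists>p :: 'a mat. p \<in> projections TYPE('a) \<and> p \<in> projections TYPE('a) \<and> mvn_equiv p p"
    using mvn_equiv_refl zero_projection by blast
  show "symp (\<lambda>p q. p \<in> projections TYPE('a) \<and> q \<in> projections TYPE('a) \<and> mvn_equiv p q)"
    by (rule sympI) (blast intro: mvn_equiv_sym)
  show "transp (\<lambda>p q. p \<in> projections TYPE('a) \<and> q \<in> projections TYPE('a) \<and> mvn_equiv p q)"
    by (rule transpI) (blast intro: mvn_equiv_trans)
qed

lemma mvn_class_eq_iff:
  fixes p q :: "'a::cstar_algebra mat"
  assumes "p \<in> projections TYPE('a)" "q \<in> projections TYPE('a)"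
  shows "mvn_class p = mvn_class q \<longleftrightarrow> mvn_equiv p q"
  using Quotient_rel[OF Quotient_mvn_class, of p q] assms mvn_equiv_refl by blast

instantiation mvn_class :: (cstar_algebra) ab_semigroup_add
begin

lift_definition plus_mvn_class :: "'a mvn_class \<Rightarrow> 'a mvn_class \<Rightarrow> 'a mvn_class" is mat_oplus
  by (auto intro: mvn_equiv_oplus)

instance
proof
  fix x y z :: "'a mvn_class"
  show "x + y + z = x + (y + z)"
    by transfer (simp add: mat_oplus_assoc mvn_equiv_refl[of _ "TYPE('a)"])
  show "x + y = y + x"
    by transfer (simp add: mvn_equiv_oplus_commute[of _ "TYPE('a)"])
qed

end

lemma mvn_class_oplus:
  fixes p q :: "'a::cstar_algebra mat"
  assumes "p \<in> projections TYPE('a)" "q \<in> projections TYPE('a)"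
  shows "mvn_class (mat_oplus p q) = mvn_class p + mvn_class q"
  using assms by (subst plus_mvn_class.abs_eq) (auto intro: mvn_equiv_refl)

lemma mvn_class_cases:
  fixes x :: "'a::cstar_algebra mvn_class"
  obtains p where "p \<in> projections TYPE('a)" "x = mvn_class p"
proof -
  have "\<exists>p. p \<in> projections TYPE('a) \<and> x = mvn_class p"
    by (induction x rule: mvn_class.abs_induct) blast
  then show ?thesis using that by blast
qed

section \<open>The Grothendieck group of the semigroup of classes\<close>

lemma K0_rel_iff:
  fixes p q p' q' :: "'a::cstar_algebra mat"
  shows "((p, q), (p', q')) \<in> K0_rel TYPE('a) \<longleftrightarrow>
    p \<in> projections TYPE('a) \<and> q \<in> projections TYPE('a) \<and>
    p' \<in> projections TYPE('a) \<and> q' \<in> projections TYPE('a) \<and>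
    (\<exists>r. mvn_class p + mvn_class q' + r = mvn_class p' + mvn_class q + r)"
proof -
  \<comment> \<open>Every element of \<open>mvn_class\<close> is the class of a projection, so the
    stabilising summand may range over the whole semigroup.\<close>
  have "(\<exists>r \<in> projections TYPE('a). mvn_equiv (mat_oplus (mat_oplus p q') r) (mat_oplus (mat_oplus p' q) r))
      \<longleftrightarrow> (\<exists>r. mvn_class p + mvn_class q' + r = mvn_class p' + mvn_class q + r)"
    (is "?L \<longleftrightarrow> ?R")
    if pr: "p \<in> projections TYPE('a)" "q \<in> projections TYPE('a)"
      "p' \<in> projections TYPE('a)" "q' \<in> projections TYPE('a)"
  proof -
    have *: "mvn_equiv (mat_oplus (mat_oplus p q') r) (mat_oplus (mat_oplus p' q) r) \<longleftrightarrow>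
        mvn_class p + mvn_class q' + mvn_class r = mvn_class p' + mvn_class q + mvn_class r"
      if "r \<in> projections TYPE('a)" for r
      using pr that by (simp flip: mvn_class_eq_iff add: mvn_class_oplus)
    show ?thesis
    proof
      assume ?L
      then show ?R using * by blast
    next
      assume ?R
      then obtain x where x: "mvn_class p + mvn_class q' + x = mvn_class p' + mvn_class q + x"
        by blast
      obtain r where "r \<in> projections TYPE('a)" "x = mvn_class r" by (rule mvn_class_cases)
      then show ?L using * x by blast
    qed
  qed
  then show ?thesis unfolding K0_rel_def by blast
qed

lemma equiv_K0_rel:
  "equiv (projections TYPE('a::cstar_algebra) \<times> projections TYPE('a)) (K0_rel TYPE('a))"
proof (rule equivI)
  show "refl_on (projections TYPE('a) \<times> projections TYPE('a)) (K0_rel TYPE('a))"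
    by (rule refl_onI) (auto simp: K0_rel_iff)
  show "sym (K0_rel TYPE('a))"
    by (rule symI, clarify, unfold K0_rel_iff) metis
  show "trans (K0_rel TYPE('a))"
  proof (rule transI, clarify)
    fix p q p' q' p'' q'' :: "'a mat"
    assume "((p, q), (p', q')) \<in> K0_rel TYPE('a)" "((p', q'), (p'', q'')) \<in> K0_rel TYPE('a)"
    then obtain r s where pr: "p \<in> projections TYPE('a)" "q \<in> projections TYPE('a)"
        "p'' \<in> projections TYPE('a)" "q'' \<in> projections TYPE('a)"
      and r: "mvn_class p + mvn_class q' + r = mvn_class p' + mvn_class q + r"
      and s: "mvn_class p' + mvn_class q'' + s = mvn_class p'' + mvn_class q' + s"
      unfolding K0_rel_iff by blast
    \<comment> \<open>The semigroup need not be cancellative, so the terms of \<open>p'\<close> and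
      \<open>q'\<close> cannot be removed after adding the two equations; they join the stabilising
      summand.\<close>
    let ?t = "mvn_class p' + mvn_class q' + r + s"
    have "mvn_class p + mvn_class q'' + ?t =
        (mvn_class p + mvn_class q' + r) + (mvn_class p' + mvn_class q'' + s)"
      by (simp only: ac_simps)
    also have "\<dots> = mvn_class p'' + mvn_class q + ?t"
      unfolding r s by (simp only: ac_simps)
    finally show "((p, q), (p'', q'')) \<in> K0_rel TYPE('a)"
      unfolding K0_rel_iff using pr by blast
  qed
qed (auto simp: K0_rel_iff)

lemma K0_diff_eq_iff:
  fixes p q p' q' :: "'a::cstar_algebra mat"
  assumes "p \<in> projections TYPE('a)" "q \<in> projections TYPE('a)"
    "p' \<in> projections TYPE('a)" "q' \<in> projections TYPE('a)"
  shows "K0_diff p q = K0_diff p' q' \<longleftrightarrow>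
    (\<exists>r. mvn_class p + mvn_class q' + r = mvn_class p' + mvn_class q + r)"
  unfolding K0_diff_def using assms
  by (subst eq_equiv_class_iff[OF equiv_K0_rel]) (simp_all add: K0_rel_iff)

lemma K0_diff_carrier:
  fixes p q :: "'a::cstar_algebra mat"
  assumes "p \<in> projections TYPE('a)" "q \<in> projections TYPE('a)"
  shows "K0_diff p q \<in> carrier (K0 TYPE('a))"
  using assms by (simp add: K0_def K0_diff_def quotientI)

lemma K0_carrier_cases:
  fixes X :: "('a::cstar_algebra mat \<times> 'a mat) set"
  assumes "X \<in> carrier (K0 TYPE('a))"
  obtains p q where "p \<in> projections TYPE('a)" "q \<in> projections TYPE('a)" "X = K0_diff p q"
  using assms by (auto simp: K0_def K0_diff_def elim!: quotientE)

text \<open>A union over all representatives of a class serves as a choice of representative: when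
  the family is constant on the class, the union is that constant. This evaluates both the
  multiplication of \<open>K0\<close> and \<open>K0_map\<close>.\<close>

lemma UN_K0_diff:
  fixes p q :: "'a::cstar_algebra mat"
  assumes pq: "p \<in> projections TYPE('a)" "q \<in> projections TYPE('a)"
    and cong: "\<And>p' q'. p' \<in> projections TYPE('a) \<Longrightarrow> q' \<in> projections TYPE('a) \<Longrightarrow>
      K0_diff p q = K0_diff p' q' \<Longrightarrow> F p' q' = F p q"
  shows "(\<Union>(p', q')\<in>K0_diff p q. F p' q') = F p q"
proof -
  have "F p' q' = F p q" if "(p', q') \<in> K0_diff p q" for p' q'
  proof -
    have "((p, q), (p', q')) \<in> K0_rel TYPE('a)" using that by (simp add: K0_diff_def)
    then show ?thesis
      using pq by (intro cong) (auto simp: K0_rel_iff K0_diff_eq_iff)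
  qed
  moreover have "(p, q) \<in> K0_diff p q"
    using pq by (auto simp: K0_diff_def K0_rel_iff)
  ultimately show ?thesis by fast
qed

text \<open>The sum of formal differences is independent of the representatives
  (\<open>cong\<close>), so the double union collapses, one class at a time.\<close>

lemma K0_mult:
  fixes p q p' q' :: "'a::cstar_algebra mat"
  assumes pr: "p \<in> projections TYPE('a)" "q \<in> projections TYPE('a)"
    "p' \<in> projections TYPE('a)" "q' \<in> projections TYPE('a)"
  shows "K0_diff p q \<otimes>\<^bsub>K0 TYPE('a)\<^esub> K0_diff p' q' =
    K0_diff (mat_oplus p p') (mat_oplus q q')"
proof -
  have cong: "K0_diff (mat_oplus a a') (mat_oplus b b') = K0_diff (mat_oplus p p') (mat_oplus q q')"
    if ab: "a \<in> projections TYPE('a)" "b \<in> projections TYPE('a)" "K0_diff p q = K0_diff a b"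
      "a' \<in> projections TYPE('a)" "b' \<in> projections TYPE('a)" "K0_diff p' q' = K0_diff a' b'"
    for a b a' b'
  proof -
    obtain r where r: "mvn_class p + mvn_class b + r = mvn_class a + mvn_class q + r"
      using ab pr by (auto simp: K0_diff_eq_iff)
    obtain s where s: "mvn_class p' + mvn_class b' + s = mvn_class a' + mvn_class q' + s"
      using ab pr by (auto simp: K0_diff_eq_iff)
    have "mvn_class a + mvn_class a' + (mvn_class q + mvn_class q') + (r + s) =
        (mvn_class a + mvn_class q + r) + (mvn_class a' + mvn_class q' + s)"
      by (simp only: ac_simps)
    also have "\<dots> = mvn_class p + mvn_class p' + (mvn_class b + mvn_class b') + (r + s)"
      unfolding r[symmetric] s[symmetric] by (simp only: ac_simps)
    finally show ?thesis
      using ab pr by (subst K0_diff_eq_iff) (auto simp: mvn_class_oplus)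
  qed
  have "K0_diff p q \<otimes>\<^bsub>K0 TYPE('a)\<^esub> K0_diff p' q' =
      (\<Union>(a, b)\<in>K0_diff p q. \<Union>(a', b')\<in>K0_diff p' q'. K0_diff (mat_oplus a a') (mat_oplus b b'))"
    by (simp add: K0_def)
  also have "\<dots> = (\<Union>(a', b')\<in>K0_diff p' q'. K0_diff (mat_oplus p a') (mat_oplus q b'))"
  proof (rule UN_K0_diff[OF pr(1,2)])
    fix a b assume ab: "a \<in> projections TYPE('a)" "b \<in> projections TYPE('a)"
      "K0_diff p q = K0_diff a b"
    have "(\<Union>(a', b')\<in>K0_diff p' q'. K0_diff (mat_oplus x a') (mat_oplus y b')) =
        K0_diff (mat_oplus p p') (mat_oplus q q')"
      if "x \<in> projections TYPE('a)" "y \<in> projections TYPE('a)" "K0_diff p q = K0_diff x y" for x y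
      using cong[OF that] cong[OF that pr(3,4)] by (subst UN_K0_diff[OF pr(3,4)]) simp_all
    from this[OF ab] this[OF pr(1,2)]
    show "(\<Union>(a', b')\<in>K0_diff p' q'. K0_diff (mat_oplus a a') (mat_oplus b b')) =
        (\<Union>(a', b')\<in>K0_diff p' q'. K0_diff (mat_oplus p a') (mat_oplus q b'))"
      by simp
  qed
  also have "\<dots> = K0_diff (mat_oplus p p') (mat_oplus q q')"
    using cong[OF pr(1,2)] by (subst UN_K0_diff[OF pr(3,4)]) simp_all
  finally show ?thesis .
qed

lemma K0_mult_closed:
  assumes "X \<in> carrier (K0 TYPE('a::cstar_algebra))" "Y \<in> carrier (K0 TYPE('a))"
  shows "X \<otimes>\<^bsub>K0 TYPE('a)\<^esub> Y \<in> carrier (K0 TYPE('a))"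
proof -
  obtain p q where "p \<in> projections TYPE('a)" "q \<in> projections TYPE('a)" "X = K0_diff p q"
    using assms(1) by (rule K0_carrier_cases)
  moreover obtain p' q' where "p' \<in> projections TYPE('a)" "q' \<in> projections TYPE('a)" "Y = K0_diff p' q'"
    using assms(2) by (rule K0_carrier_cases)
  ultimately show ?thesis by (simp add: K0_mult K0_diff_carrier)
qed

section \<open>The map on \<open>K0\<close> induced by a star-homomorphism\<close>

definition K0_map :: "('a::cstar_algebra \<Rightarrow> 'b::cstar_algebra) \<Rightarrow>
    ('a mat \<times> 'a mat) set \<Rightarrow> ('b mat \<times> 'b mat) set" where
  "K0_map \<phi> X = (\<Union>(p, q)\<in>X. K0_diff (map_mat \<phi> p) (map_mat \<phi> q))"

context
  fixes \<phi> :: "'a::cstar_algebra \<Rightarrow> 'b::cstar_algebra"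
  assumes star_hom: "star_hom \<phi>"
begin

lemma star_hom_0: "\<phi> 0 = 0"
proof -
  have "\<phi> (0 + 0) = \<phi> 0 + \<phi> 0" using star_hom unfolding star_hom_def by blast
  then show ?thesis by simp
qed

lemma star_hom_sum: "\<phi> (sum f A) = (\<Sum>x\<in>A. \<phi> (f x))"
  using star_hom by (induction A rule: infinite_finite_induct) (simp_all add: star_hom_0 star_hom_def)

lemma map_mat_star_hom_mult:
  assumes "A \<in> carrier_mat k l" "B \<in> carrier_mat l n"
  shows "map_mat \<phi> (A * B) = map_mat \<phi> A * map_mat \<phi> B"
  using assms star_hom
  by (intro eq_matI) (simp_all add: scalar_prod_def star_hom_sum star_hom_def)

lemma map_mat_star_hom_adj: "map_mat \<phi> (adj_mat A) = adj_mat (map_mat \<phi> A)"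
  using star_hom by (intro eq_matI) (simp_all add: star_hom_def)

lemma map_mat_star_hom_oplus:
  "map_mat \<phi> (mat_oplus p q) = mat_oplus (map_mat \<phi> p) (map_mat \<phi> q)"
  by (rule eq_matI) (auto simp: mat_oplus_def star_hom_0 four_block_mat_def Let_def)

lemma map_mat_star_hom_projection [simp]:
  assumes "p \<in> projections TYPE('a)"
  shows "map_mat \<phi> p \<in> projections TYPE('b)"
proof -
  obtain n where n: "p \<in> carrier_mat n n" "p * p = p" "adj_mat p = p"
    using assms by (rule projectionsE)
  then show ?thesis
    by (intro projectionsI[of _ n])
      (simp_all flip: map_mat_star_hom_mult[of _ n n _ n] map_mat_star_hom_adj)
qed

text \<open>The entrywise image of the partial isometry implements the equivalence of the
  images.\<close>

lemma mvn_equiv_map_mat: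
  assumes "p \<in> projections TYPE('a)" "q \<in> projections TYPE('a)" "mvn_equiv p q"
  shows "mvn_equiv (map_mat \<phi> p) (map_mat \<phi> q)"
proof -
  note c = projection_carrier[OF assms(1)] projection_carrier[OF assms(2)]
  obtain w where w: "w \<in> carrier_mat (dim_row q) (dim_row p)" "adj_mat w * w = p" "w * adj_mat w = q"
    by (rule mvn_equivE[OF assms(3) c])
  show ?thesis
  proof (rule mvn_equivI[of _ "dim_row q" "dim_row p"])
    show "map_mat \<phi> w \<in> carrier_mat (dim_row q) (dim_row p)"
      using w(1) by simp
    show "map_mat \<phi> p \<in> carrier_mat (dim_row p) (dim_row p)"
      "map_mat \<phi> q \<in> carrier_mat (dim_row q) (dim_row q)"
      using c by (simp_all only: map_carrier_mat)
    show "adj_mat (map_mat \<phi> w) * map_mat \<phi> w = map_mat \<phi> p"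
      using map_mat_star_hom_mult[OF adj_mat_carrier[OF w(1)] w(1)]
      by (simp only: w(2) map_mat_star_hom_adj)
    show "map_mat \<phi> w * adj_mat (map_mat \<phi> w) = map_mat \<phi> q"
      using map_mat_star_hom_mult[OF w(1) adj_mat_carrier[OF w(1)]]
      by (simp only: w(3) map_mat_star_hom_adj)
  qed
qed

text \<open>Well-definedness: \<phi> carries the stabilised equivalence behind an equality of
  differences, including the stabilising projection, to one between the images.\<close>

lemma K0_map_diff:
  assumes pq: "p \<in> projections TYPE('a)" "q \<in> projections TYPE('a)"
  shows "K0_map \<phi> (K0_diff p q) = K0_diff (map_mat \<phi> p) (map_mat \<phi> q)"
  unfolding K0_map_def
proof (rule UN_K0_diff[OF pq])
  fix p' q' :: "'a mat"
  assume p'q': "p' \<in> projections TYPE('a)" "q' \<in> projections TYPE('a)"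
    and "K0_diff p q = K0_diff p' q'"
  then obtain x where x: "mvn_class p + mvn_class q' + x = mvn_class p' + mvn_class q + x"
    using pq by (auto simp: K0_diff_eq_iff)
  obtain r where r: "r \<in> projections TYPE('a)" and xr: "x = mvn_class r" by (rule mvn_class_cases)
  have "mvn_equiv (mat_oplus (mat_oplus p q') r) (mat_oplus (mat_oplus p' q) r)"
    using x pq p'q' r by (subst mvn_class_eq_iff[symmetric]) (simp_all add: mvn_class_oplus xr)
  then have "mvn_equiv (map_mat \<phi> (mat_oplus (mat_oplus p q') r))
      (map_mat \<phi> (mat_oplus (mat_oplus p' q) r))"
    using pq p'q' r by (intro mvn_equiv_map_mat) simp_all
  then have "mvn_class (map_mat \<phi> p) + mvn_class (map_mat \<phi> q') + mvn_class (map_mat \<phi> r) =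
      mvn_class (map_mat \<phi> p') + mvn_class (map_mat \<phi> q) + mvn_class (map_mat \<phi> r)"
    using pq p'q' r by (simp flip: mvn_class_eq_iff add: mvn_class_oplus map_mat_star_hom_oplus)
  then have "\<exists>s. mvn_class (map_mat \<phi> p') + mvn_class (map_mat \<phi> q) + s =
      mvn_class (map_mat \<phi> p) + mvn_class (map_mat \<phi> q') + s"
    by (intro exI[of _ "mvn_class (map_mat \<phi> r)"]) (rule sym)
  then show "K0_diff (map_mat \<phi> p') (map_mat \<phi> q') = K0_diff (map_mat \<phi> p) (map_mat \<phi> q)"
    by (subst K0_diff_eq_iff) (simp_all only: map_mat_star_hom_projection pq p'q')
qed

lemma K0_map_hom: "K0_map \<phi> \<in> hom (K0 TYPE('a)) (K0 TYPE('b))"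
proof (rule homI)
  fix X assume "X \<in> carrier (K0 TYPE('a))"
  then obtain p q where "p \<in> projections TYPE('a)" "q \<in> projections TYPE('a)" "X = K0_diff p q"
    by (rule K0_carrier_cases)
  then show "K0_map \<phi> X \<in> carrier (K0 TYPE('b))"
    by (simp add: K0_map_diff K0_diff_carrier)
next
  fix X Y assume X: "X \<in> carrier (K0 TYPE('a))" and Y: "Y \<in> carrier (K0 TYPE('a))"
  obtain p q where "p \<in> projections TYPE('a)" "q \<in> projections TYPE('a)" "X = K0_diff p q"
    using X by (rule K0_carrier_cases)
  moreover obtain p' q' where "p' \<in> projections TYPE('a)" "q' \<in> projections TYPE('a)" "Y = K0_diff p' q'"
    using Y by (rule K0_carrier_cases)
  ultimately show "K0_map \<phi> (X \<otimes>\<^bsub>K0 TYPE('a)\<^esub> Y) = K0_map \<phi> X \<otimes>\<^bsub>K0 TYPE('b)\<^esub> K0_map \<phi> Y"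
    by (simp add: K0_map_diff K0_mult map_mat_star_hom_oplus)
qed

lemma K0_map_class:
  "p \<in> projections TYPE('a) \<Longrightarrow> K0_map \<phi> (K0_class p) = K0_class (map_mat \<phi> p)"
proof -
  assume p: "p \<in> projections TYPE('a)"
  have "map_mat \<phi> (0\<^sub>m 1 1) = 0\<^sub>m 1 1" by (rule eq_matI) (simp_all add: star_hom_0)
  then show ?thesis using K0_map_diff[OF p zero_projection, of 1] by (simp add: K0_class_def)
qed

lemma K0_map_pos: "X \<in> K0_pos TYPE('a) \<Longrightarrow> K0_map \<phi> X \<in> K0_pos TYPE('b)"
  by (auto simp: K0_pos_def K0_map_class)

lemma K0_map_unit:
  assumes "\<phi> 1 = 1"
  shows "K0_map \<phi> (K0_unit TYPE('a)) = K0_unit TYPE('b)"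
proof -
  have "map_mat \<phi> (1\<^sub>m 1) = 1\<^sub>m 1" by (rule eq_matI) (simp_all add: assms)
  then show ?thesis by (simp add: K0_unit_def K0_map_class)
qed

end


section \<open>Dimension groups with integral eigenvalue \<open>m\<^sub>N\<close>\<close>

lemma std_mat_carrier [simp]: "std_mat N m \<in> carrier_mat N N"
  by (simp add: std_mat_def)

lemma dim_row_std_mat [simp]: "dim_row (std_mat N m) = N"
  by (simp add: std_mat_def)

text \<open>Row \<open>i\<close> meets only the first column and the superdiagonal; the conditional
  accounts for the last row, which has no superdiagonal entry.\<close>

lemma std_mat_mult_vec_nth:
  fixes w :: "'a::comm_semiring_1 vec"
  assumes "w \<in> carrier_vec N" and "i < N"
  shows "(std_mat N m *\<^sub>v w) $ i =
    of_nat (m (i + 1)) * w $ 0 + (if i + 1 < N then w $ (i + 1) else 0)"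
proof -
  let ?r = "\<lambda>j. (if j = 0 then of_nat (m (i + 1)) else if j = i + 1 then 1 else 0) * w $ j"
  have "(std_mat N m *\<^sub>v w) $ i = (\<Sum>j<N. ?r j)"
    using assms by (simp add: std_mat_def scalar_prod_def atLeast0LessThan)
  also have "\<dots> = (\<Sum>j<N. (if j = 0 then of_nat (m (i + 1)) * w $ 0 else 0) +
      (if j = i + 1 then w $ (i + 1) else 0))"
    by (rule sum.cong) auto
  also have "\<dots> = of_nat (m (i + 1)) * w $ 0 + (if i + 1 < N then w $ (i + 1) else 0)"
    using assms by (simp add: sum.distrib)
  finally show ?thesis .
qed

text \<open>Solving \<open>J v = \<lambda> v\<close>, \<open>v\<^sub>0 = 1\<close> row by row from the top; the value at index \<open>N\<close> is the
  characteristic polynomial of \<open>J\<close> at \<open>\<lambda>\<close>.\<close>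
primrec right_entry :: "nat \<Rightarrow> (nat \<Rightarrow> nat) \<Rightarrow> nat \<Rightarrow> int" where
  "right_entry l m 0 = 1"
| "right_entry l m (Suc i) = int l * right_entry l m i - int (m (Suc i))"

text \<open>The Perron-Frobenius condition enters as \<open>char_eq\<close>, which says that
  \<open>m N\<close> is a root of the characteristic polynomial. All later computations then take
  place over the integers and rationals; \<open>right_pf_vector_entries\<close> provides the passage
  from real data.\<close>

locale integral_eigenvalue =
  fixes N :: nat and m :: "nat \<Rightarrow> nat"
  assumes N_pos: "N > 0" and eigenvalue_pos: "m N > 0"
    and char_eq: "right_entry (m N) m N = 0"
begin

abbreviation J :: "rat mat" where "J \<equiv> std_mat N m"
abbreviation lam :: rat where "lam \<equiv> of_nat (m N)"
abbreviation G :: "rat vec set" where "G \<equiv> carrier (G_group N m)"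

text \<open>The pairing with \<alpha> for the eigenvalue \<open>m N\<close>, kept rational;
  \<open>scalar_prod_alpha\<close> gives the comparison with \<open>alpha\<close>.\<close>

definition trace :: "rat vec \<Rightarrow> rat" where
  "trace g = (\<Sum>i<N. g $ i / lam ^ i)"

text \<open>The Perron-Frobenius column vector v, which has integer entries here.\<close>

definition u :: "rat vec" where
  "u = vec N (\<lambda>i. of_int (right_entry (m N) m i))"

lemma lam_pos: "lam > 0"
  using eigenvalue_pos by simp

lemma mem_G_iff:
  "g \<in> G \<longleftrightarrow> g \<in> carrier_vec N \<and> (\<exists>n. \<forall>i<N. ((J ^\<^sub>m n) *\<^sub>v g) $ i \<in> \<int>)"
  by (simp add: G_group_def)

lemma G_carrier_vec: "g \<in> G \<Longrightarrow> g \<in> carrier_vec N"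
  by (simp add: mem_G_iff)

lemma J_power_carrier [simp]: "J ^\<^sub>m n \<in> carrier_mat N N"
  by simp

text \<open>The recursion of \<open>right_entry\<close>, divided by powers of \<open>lam\<close>,
  telescopes; at \<open>N\<close> the remainder vanishes by \<open>char_eq\<close>. This is the
  first coordinate of the left eigenvector equation for \<alpha>.\<close>

lemma sum_first_column: "(\<Sum>i<N. of_nat (m (i + 1)) / lam ^ i) = lam"
proof -
  have "(\<Sum>i<n. of_nat (m (i + 1)) / lam ^ i)
      = lam * (1 - of_int (right_entry (m N) m n) / lam ^ n)" for n
    using lam_pos by (induction n) (simp_all add: diff_divide_distrib right_diff_distrib)
  from this[of N] show ?thesis using char_eq by simp
qed

text \<open>The first column contributes \<open>lam * g $ 0\<close> by
  \<open>sum_first_column\<close>; the superdiagonal shifts the other entries by one place, which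
  costs one factor \<open>lam\<close> in their weights.\<close>

lemma trace_J_mult:
  assumes "g \<in> carrier_vec N"
  shows "trace (J *\<^sub>v g) = lam * trace g"
proof -
  obtain k where k: "N = Suc k" using N_pos not0_implies_Suc by blast
  have "trace (J *\<^sub>v g) = (\<Sum>i<N. of_nat (m (i + 1)) / lam ^ i * g $ 0 +
      (if i + 1 < N then g $ (i + 1) / lam ^ i else 0))"
    unfolding trace_def by (rule sum.cong) (simp_all add: assms std_mat_mult_vec_nth add_divide_distrib
        del: index_mult_mat_vec)
  also have "\<dots> = lam * g $ 0 + (\<Sum>i<N. (if i + 1 < N then g $ (i + 1) / lam ^ i else 0))"
    by (simp only: sum.distrib sum_distrib_right[symmetric] sum_first_column)
  also have "(\<Sum>i<N. (if i + 1 < N then g $ (i + 1) / lam ^ i else 0)) = (\<Sum>i<k. g $ (i + 1) / lam ^ i)"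
    unfolding k by simp
  also have "\<dots> = lam * (\<Sum>i<k. g $ (i + 1) / lam ^ (i + 1))"
    using lam_pos by (simp add: sum_distrib_left)
  also have "lam * g $ 0 + \<dots> = lam * trace g"
    unfolding trace_def by (subst (4) k, subst sum.lessThan_Suc_shift) (simp add: algebra_simps)
  finally show ?thesis .
qed

lemma J_power_0_mult: "g \<in> carrier_vec N \<Longrightarrow> (J ^\<^sub>m 0) *\<^sub>v g = g"
  by simp

lemma J_power_Suc_mult: "g \<in> carrier_vec N \<Longrightarrow> (J ^\<^sub>m Suc n) *\<^sub>v g = (J ^\<^sub>m n) *\<^sub>v (J *\<^sub>v g)"
  by (simp add: assoc_mult_mat_vec[of _ N N _ N])

lemma J_power_add_mult:
  "g \<in> carrier_vec N \<Longrightarrow> (J ^\<^sub>m (n + k)) *\<^sub>v g = (J ^\<^sub>m n) *\<^sub>v ((J ^\<^sub>m k) *\<^sub>v g)"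
proof (induction k arbitrary: g)
  case 0
  then show ?case by (simp only: J_power_0_mult) simp
next
  case (Suc k)
  have c: "J *\<^sub>v g \<in> carrier_vec N"
    using Suc.prems by (simp add: mult_mat_vec_carrier[of _ N N])
  show ?case
    by (simp only: add_Suc_right J_power_Suc_mult[OF Suc.prems] Suc.IH[OF c])
qed

lemma J_power_mult_integral:
  assumes "g \<in> carrier_vec N" and "\<forall>i<N. g $ i \<in> \<int>"
  shows "\<forall>i<N. ((J ^\<^sub>m n) *\<^sub>v g) $ i \<in> \<int>"
  using assms
proof (induction n arbitrary: g)
  case 0
  then show ?case by (simp only: J_power_0_mult)
next
  case (Suc n)
  have c: "J *\<^sub>v g \<in> carrier_vec N"
    using Suc.prems by (simp add: mult_mat_vec_carrier[of _ N N])
  have "(J *\<^sub>v g) $ i \<in> \<int>" if "i < N" for i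
    unfolding std_mat_mult_vec_nth[OF Suc.prems(1) that]
    using N_pos Suc.prems(2) by (auto intro!: Ints_add Ints_mult)
  then show ?case
    unfolding J_power_Suc_mult[OF Suc.prems(1)] by (intro Suc.IH[OF c] allI impI)
qed

lemma trace_J_power_mult:
  "g \<in> carrier_vec N \<Longrightarrow> trace ((J ^\<^sub>m n) *\<^sub>v g) = lam ^ n * trace g"
proof (induction n arbitrary: g)
  case 0
  then show ?case by (simp only: J_power_0_mult) simp
next
  case (Suc n)
  have c: "J *\<^sub>v g \<in> carrier_vec N"
    using Suc.prems by (simp add: mult_mat_vec_carrier[of _ N N])
  show ?case
    by (simp only: J_power_Suc_mult[OF Suc.prems] Suc.IH[OF c] trace_J_mult[OF Suc.prems]) simp
qed

lemma trace_add:
  "x \<in> carrier_vec N \<Longrightarrow> y \<in> carrier_vec N \<Longrightarrow> trace (x + y) = trace x + trace y"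
  by (simp add: trace_def sum.distrib add_divide_distrib)

lemma trace_smult: "x \<in> carrier_vec N \<Longrightarrow> trace (c \<cdot>\<^sub>v x) = c * trace x"
  by (simp add: trace_def sum_distrib_left)

text \<open>The weights of the trace have denominators dividing
  \<open>lam ^ (N - 1)\<close>.\<close>

lemma trace_integral:
  assumes "\<forall>i<N. g $ i \<in> \<int>"
  shows "lam ^ (N - 1) * trace g \<in> \<int>"
proof -
  have "lam ^ (N - 1) * trace g = (\<Sum>i<N. g $ i * lam ^ (N - 1 - i))"
    unfolding trace_def sum_distrib_left
  proof (rule sum.cong)
    fix i assume "i \<in> {..<N}"
    then have "lam ^ (N - 1) = lam ^ (N - 1 - i) * lam ^ i"
      by (simp flip: power_add)
    then show "lam ^ (N - 1) * (g $ i / lam ^ i) = g $ i * lam ^ (N - 1 - i)"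
      using lam_pos by simp
  qed simp
  also have "\<dots> \<in> \<int>"
    using assms by (auto intro!: Ints_sum Ints_mult Ints_power)
  finally show ?thesis .
qed

text \<open>On the kernel of the trace \<open>J\<close> is unimodular: the last entry \<open>m N * g 0\<close> of \<open>J g\<close> is
  divisible by \<open>m N\<close> because the trace of \<open>J g\<close> vanishes.\<close>
lemma integral_if_J_integral:
  assumes g: "g \<in> carrier_vec N" and tr: "trace g = 0" and int: "\<forall>i<N. (J *\<^sub>v g) $ i \<in> \<int>"
  shows "\<forall>i<N. g $ i \<in> \<int>"
proof -
  obtain k where k: "N = Suc k" using N_pos not0_implies_Suc by blast
  let ?w = "J *\<^sub>v g"
  have N: "{..<N} = insert k {..<k}" using k by auto
  \<comment> \<open>After clearing denominators, every term but the last carries a factor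
    \<open>lam\<close>, and the last entry of \<open>?w\<close> is itself
    \<open>lam * g $ 0\<close>. Cancelling \<open>lam\<close> expresses \<open>g $ 0\<close> through
    integers.\<close>
  have "0 = lam ^ k * trace ?w" using tr by (simp add: trace_J_mult g)
  also have "\<dots> = (\<Sum>i<k. lam ^ k * (?w $ i / lam ^ i)) + ?w $ k"
    using lam_pos unfolding trace_def N by (simp add: sum_distrib_left distrib_left)
  also have "(\<Sum>i<k. lam ^ k * (?w $ i / lam ^ i)) = (\<Sum>i<k. lam * (?w $ i * lam ^ (k - 1 - i)))"
    proof (rule sum.cong)
      fix i assume "i \<in> {..<k}"
      then have "lam ^ k = lam ^ Suc (k - 1 - i) * lam ^ i"
        using power_add[of lam "Suc (k - 1 - i)" i] by simp
      then show "lam ^ k * (?w $ i / lam ^ i) = lam * (?w $ i * lam ^ (k - 1 - i))"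
        using lam_pos by simp
    qed simp
  also have "?w $ k = lam * g $ 0"
    using std_mat_mult_vec_nth[OF g, of k m] k by simp
  finally have "lam * ((\<Sum>i<k. ?w $ i * lam ^ (k - 1 - i)) + g $ 0) = 0"
    by (simp only: distrib_left sum_distrib_left)
  then have "(\<Sum>i<k. ?w $ i * lam ^ (k - 1 - i)) + g $ 0 = 0"
    using lam_pos by (simp only: mult_eq_0_iff) simp
  then have "g $ 0 = - (\<Sum>i<k. ?w $ i * lam ^ (k - 1 - i))"
    by (simp only: eq_neg_iff_add_eq_0 add.commute)
  also have "\<dots> \<in> \<int>"
    by (intro Ints_minus Ints_sum Ints_mult Ints_power int[rule_format]) (simp_all add: k)
  finally have g0: "g $ 0 \<in> \<int>" .
  show ?thesis
  proof (intro allI impI)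
    fix i assume i: "i < N"
    show "g $ i \<in> \<int>"
    proof (cases i)
      case 0 then show ?thesis using g0 by simp
    next
      case (Suc j)
      then have j: "j < N" "j + 1 < N" using i by auto
      \<comment> \<open>Once \<open>g $ 0\<close> is an integer, row \<open>j\<close> of
        \<open>J\<close> gives the entry at \<open>j + 1\<close>.\<close>
      have "g $ i = ?w $ j - of_nat (m (j + 1)) * g $ 0"
        using std_mat_mult_vec_nth[OF g j(1), of m] j(2) by (simp add: Suc)
      moreover have "?w $ j \<in> \<int>" using int j(1) by blast
      ultimately show ?thesis using g0 by (simp add: Ints_diff Ints_mult)
    qed
  qed
qed

text \<open>Powers of \<open>J\<close> are removed one at a time by
  \<open>integral_if_J_integral\<close>; trace 0 persists since \<open>J\<close> scales the
  trace.\<close>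

lemma integral_if_trace_zero:
  assumes "g \<in> G" and "trace g = 0"
  shows "\<forall>i<N. g $ i \<in> \<int>"
proof -
  obtain n where "g \<in> carrier_vec N" "\<forall>i<N. ((J ^\<^sub>m n) *\<^sub>v g) $ i \<in> \<int>"
    using assms by (auto simp: mem_G_iff)
  then show ?thesis using \<open>trace g = 0\<close>
  proof (induction n arbitrary: g)
    case 0
    then show ?case by (simp only: J_power_0_mult)
  next
    case (Suc n)
    have c: "J *\<^sub>v g \<in> carrier_vec N"
      using Suc.prems by (simp add: mult_mat_vec_carrier[of _ N N])
    have "\<forall>i<N. (J *\<^sub>v g) $ i \<in> \<int>"
    proof (rule Suc.IH[OF c])
      show "\<forall>i<N. ((J ^\<^sub>m n) *\<^sub>v (J *\<^sub>v g)) $ i \<in> \<int>"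
        using Suc.prems(2) unfolding J_power_Suc_mult[OF Suc.prems(1)] .
      show "trace (J *\<^sub>v g) = 0"
        unfolding trace_J_mult[OF Suc.prems(1)] by (simp add: Suc.prems(3))
    qed
    then show ?case by (rule integral_if_J_integral[OF Suc.prems(1,3)])
  qed
qed

section \<open>The right eigenvector\<close>

lemma u_carrier [simp]: "u \<in> carrier_vec N"
  by (simp add: u_def)

lemma dim_u [simp]: "dim_vec u = N"
  by (simp add: u_def)

lemma u_0: "u $ 0 = 1"
  using N_pos by (simp add: u_def)

text \<open>Each row is one step of the recursion of \<open>right_entry\<close>; in the last row the
  absent superdiagonal term agrees with the value at \<open>N\<close>, which is 0 by
  \<open>char_eq\<close>.\<close>

lemma J_u: "J *\<^sub>v u = lam \<cdot>\<^sub>v u"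
proof (rule eq_vecI)
  fix i assume "i < dim_vec (lam \<cdot>\<^sub>v u)"
  then have i: "i < N" by (simp add: u_def)
  let ?r = "\<lambda>i. rat_of_int (right_entry (m N) m i)"
  have "(J *\<^sub>v u) $ i = of_nat (m (i + 1)) + ?r (i + 1)"
  proof (cases "i + 1 < N")
    case True
    then show ?thesis
      unfolding std_mat_mult_vec_nth[OF u_carrier i] u_0 by (simp add: u_def)
  next
    case False
    then have "i + 1 = N" using i by simp
    then show ?thesis
      unfolding std_mat_mult_vec_nth[OF u_carrier i] u_0 by (simp only: char_eq) simp
  qed
  also have "\<dots> = lam * ?r i" by simp
  finally show "(J *\<^sub>v u) $ i = (lam \<cdot>\<^sub>v u) $ i"
    using i by (simp add: u_def)
qed (simp add: u_def std_mat_def)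

lemma J_power_u: "(J ^\<^sub>m n) *\<^sub>v u = lam ^ n \<cdot>\<^sub>v u"
proof (induction n)
  case 0
  show ?case by (simp only: J_power_0_mult[OF u_carrier]) simp
next
  case (Suc n)
  have "(J ^\<^sub>m Suc n) *\<^sub>v u = lam \<cdot>\<^sub>v ((J ^\<^sub>m n) *\<^sub>v u)"
    by (simp only: J_power_Suc_mult[OF u_carrier] J_u mult_mat_vec[OF J_power_carrier u_carrier])
  then show ?case by (simp add: Suc smult_smult_assoc)
qed

text \<open>Downward induction from the value 0 at \<open>N\<close>: \<open>lam\<close> times an
  entry is the next entry plus a nonnegative coefficient.\<close>

lemma right_entry_nonneg: "i \<le> N \<Longrightarrow> right_entry (m N) m i \<ge> 0"
proof (induction rule: inc_induct)
  case (step n)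
  then have "int (m N) * right_entry (m N) m n \<ge> 0" by simp
  then show ?case using eigenvalue_pos by (simp add: zero_le_mult_iff)
qed (simp add: char_eq)

lemma trace_u_pos: "trace u > 0"
  unfolding trace_def
proof (rule sum_pos2[of _ 0])
  fix i assume "i \<in> {..<N}"
  then show "0 \<le> u $ i / lam ^ i" by (simp add: u_def right_entry_nonneg)
qed (use N_pos in \<open>simp_all add: u_0\<close>)

section \<open>Membership in the dimension group\<close>

lemma add_mem_G:
  assumes "x \<in> G" "y \<in> G"
  shows "x + y \<in> G"
proof -
  \<comment> \<open>Integrality survives further applications of \<open>J\<close>, so two elements
    admit a common exponent.\<close>
  have mono: "\<forall>i<N. ((J ^\<^sub>m (k + n)) *\<^sub>v g) $ i \<in> \<int>"
    if "\<forall>i<N. ((J ^\<^sub>m n) *\<^sub>v g) $ i \<in> \<int>" "g \<in> carrier_vec N" for k n g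
    unfolding J_power_add_mult[OF that(2)]
    by (rule J_power_mult_integral[OF _ that(1)])
      (rule mult_mat_vec_carrier[OF J_power_carrier that(2)])
  obtain n where n: "x \<in> carrier_vec N" "\<forall>i<N. ((J ^\<^sub>m n) *\<^sub>v x) $ i \<in> \<int>"
    using assms by (auto simp: mem_G_iff)
  obtain k where k: "y \<in> carrier_vec N" "\<forall>i<N. ((J ^\<^sub>m k) *\<^sub>v y) $ i \<in> \<int>"
    using assms by (auto simp: mem_G_iff)
  have "\<forall>i<N. ((J ^\<^sub>m (k + n)) *\<^sub>v (x + y)) $ i \<in> \<int>"
    unfolding mult_add_distrib_mat_vec[OF J_power_carrier n(1) k(1)]
    using mono[OF n(2,1), of k] mono[OF k(2,1), of n] k(1)
    by (simp add: Ints_add add.commute[of n k])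
  then show ?thesis using n k by (auto simp: mem_G_iff)
qed

lemma smult_mem_G:
  assumes "x \<in> G" "c \<in> \<int>"
  shows "c \<cdot>\<^sub>v x \<in> G"
proof -
  obtain n where n: "x \<in> carrier_vec N" "\<forall>i<N. ((J ^\<^sub>m n) *\<^sub>v x) $ i \<in> \<int>"
    using assms by (auto simp: mem_G_iff)
  have "\<forall>i<N. ((J ^\<^sub>m n) *\<^sub>v (c \<cdot>\<^sub>v x)) $ i \<in> \<int>"
    unfolding mult_mat_vec[OF J_power_carrier n(1)]
    using n assms by (simp add: Ints_mult)
  then show ?thesis using n by (auto simp: mem_G_iff)
qed

text \<open>As \<open>J ^ k\<close> multiplies \<open>u\<close> by \<open>lam ^ k\<close>, the
  eigenvector is divisible in the group by every power of \<open>lam\<close>.\<close>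

lemma u_div_mem_G: "(1 / lam ^ k) \<cdot>\<^sub>v u \<in> G"
proof -
  have "(J ^\<^sub>m k) *\<^sub>v ((1 / lam ^ k) \<cdot>\<^sub>v u) = u"
    using lam_pos by (simp add: mult_mat_vec[of _ N N] J_power_u smult_smult_assoc)
  moreover have "\<forall>i<N. u $ i \<in> \<int>" by (simp add: u_def)
  ultimately show ?thesis
    unfolding mem_G_iff by (intro conjI exI[of _ k]) simp_all
qed

lemma unit_mem_G: "G_unit N \<in> G"
  unfolding mem_G_iff G_unit_def
proof (intro conjI exI[of _ 0])
  show "\<forall>i<N. ((J ^\<^sub>m 0) *\<^sub>v unit_vec N 0) $ i \<in> \<int>"
    unfolding J_power_0_mult[OF unit_vec_carrier] by (simp add: unit_vec_def)
qed simp

lemma trace_unit: "trace (G_unit N) = 1"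
proof -
  have "trace (G_unit N) = (\<Sum>i<N. if i = 0 then 1 else 0)"
    unfolding trace_def G_unit_def by (rule sum.cong) (auto simp: unit_vec_def)
  then show ?thesis using N_pos by simp
qed

text \<open>Projecting along \<open>u\<close> to the kernel of the trace and clearing denominators gives \<open>\<pi>\<close>, with values
  in the integer vectors, where only 0 is divisible by all powers of \<open>\<lambda>\<close>.\<close>
lemma multiple_of_u_if_divisible:
  assumes g: "g \<in> G" and lam: "m N \<ge> 2" and div: "\<And>k. \<exists>x\<in>G. g = lam ^ k \<cdot>\<^sub>v x"
  obtains c n where "g = c \<cdot>\<^sub>v u" "lam ^ n * c \<in> \<int>"
proof -
  \<comment> \<open>With this factor the traces of the two summands of \<open>\<pi> x\<close>
    cancel; the power of \<open>lam\<close> makes \<open>q\<close> an integer.\<close>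
  define q where "q = lam ^ (N - 1) * trace u"
  define \<pi> where "\<pi> x = q \<cdot>\<^sub>v x + (- (lam ^ (N - 1) * trace x)) \<cdot>\<^sub>v u" for x
  have q: "q \<in> \<int>" unfolding q_def by (rule trace_integral) (simp add: u_def)
  have q0: "q \<noteq> 0" using trace_u_pos eigenvalue_pos by (simp add: q_def)
  have int: "\<forall>i<N. \<pi> x $ i \<in> \<int>" if x: "x \<in> G" for x
  proof (rule integral_if_trace_zero)
    have xc: "x \<in> carrier_vec N" using x by (rule G_carrier_vec)
    then show "trace (\<pi> x) = 0"
      unfolding \<pi>_def by (simp add: trace_add trace_smult) (simp add: q_def)
    obtain n where n: "\<forall>i<N. ((J ^\<^sub>m n) *\<^sub>v x) $ i \<in> \<int>"
      using x by (auto simp: mem_G_iff)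
    \<comment> \<open>Applying \<open>J ^ n\<close> to \<open>\<pi> x\<close> turns the coefficient
      of \<open>u\<close> into minus this integer.\<close>
    have "lam ^ (N - 1) * trace ((J ^\<^sub>m n) *\<^sub>v x) \<in> \<int>"
      by (rule trace_integral[OF n])
    then have "\<forall>i<N. ((J ^\<^sub>m n) *\<^sub>v (\<pi> x)) $ i \<in> \<int>"
    proof (intro allI impI)
      fix i assume i: "i < N"
      have "(J ^\<^sub>m n) *\<^sub>v \<pi> x = q \<cdot>\<^sub>v ((J ^\<^sub>m n) *\<^sub>v x) +
          (- (lam ^ (N - 1) * trace x)) \<cdot>\<^sub>v (lam ^ n \<cdot>\<^sub>v u)"
        unfolding \<pi>_def mult_add_distrib_mat_vec[OF J_power_carrier smult_carrier_vec[THEN iffD2, OF xc]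
            smult_carrier_vec[THEN iffD2, OF u_carrier]]
          mult_mat_vec[OF J_power_carrier xc] mult_mat_vec[OF J_power_carrier u_carrier] J_power_u ..
      then have "((J ^\<^sub>m n) *\<^sub>v \<pi> x) $ i = q * ((J ^\<^sub>m n) *\<^sub>v x) $ i -
          lam ^ (N - 1) * trace ((J ^\<^sub>m n) *\<^sub>v x) * u $ i"
        unfolding trace_J_power_mult[OF xc]
        using i xc by (simp del: index_mult_mat_vec)
      moreover have "u $ i \<in> \<int>" using i by (simp add: u_def)
      ultimately show "((J ^\<^sub>m n) *\<^sub>v \<pi> x) $ i \<in> \<int>"
        using n i q \<open>_ * trace ((J ^\<^sub>m n) *\<^sub>v x) \<in> \<int>\<close> by (simp add: Ints_diff Ints_mult del: index_mult_mat_vec)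
    qed
    moreover have "\<pi> x \<in> carrier_vec N" using xc by (simp add: \<pi>_def)
    ultimately show "\<pi> x \<in> G" unfolding mem_G_iff by blast
  qed
  have "\<pi> g $ i = 0" if i: "i < N" for i
  proof -
    obtain z where z: "\<pi> g $ i = of_int z" using int[OF g] i by (auto elim: Ints_cases)
    have "int (m N) ^ k dvd z" for k
    proof -
      obtain x where x: "x \<in> G" "g = lam ^ k \<cdot>\<^sub>v x" using div by blast
      then have xc: "x \<in> carrier_vec N" by (auto intro: G_carrier_vec)
      obtain y where y: "\<pi> x $ i = of_int y" using int[OF x(1)] i by (auto elim: Ints_cases)
      \<comment> \<open>Linearity of \<pi> passes divisibility from \<open>g\<close> to the integer
        entries of \<open>\<pi> g\<close>.\<close>
      have "\<pi> g $ i = lam ^ k * \<pi> x $ i"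
        using i xc by (simp add: \<pi>_def x(2) trace_smult u_def algebra_simps)
      then have "rat_of_int z = rat_of_int (int (m N) ^ k * y)"
        unfolding y z by simp
      then have "z = int (m N) ^ k * y" by (simp only: of_int_eq_iff)
      then show ?thesis by simp
    qed
    \<comment> \<open>The exponent \<open>k\<close> is taken to be the absolute value of
      \<open>z\<close>: since \<open>lam\<close> is at least 2, that power exceeds \<open>z\<close>
      and cannot divide it unless \<open>z = 0\<close>.\<close>
    then have "z \<noteq> 0 \<Longrightarrow> \<bar>int (m N) ^ nat \<bar>z\<bar>\<bar> \<le> \<bar>z\<bar>"
      using dvd_imp_le_int by blast
    moreover have "\<bar>z\<bar> < int (m N) ^ nat \<bar>z\<bar>"
    proof -
      have "nat \<bar>z\<bar> < 2 ^ nat \<bar>z\<bar>" by (rule less_exp)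
      also have "\<dots> \<le> m N ^ nat \<bar>z\<bar>" using lam by (rule power_mono) simp
      finally have "int (nat \<bar>z\<bar>) < int (m N ^ nat \<bar>z\<bar>)" by (simp only: of_nat_less_iff)
      then show ?thesis by simp
    qed
    ultimately have "z = 0" by fastforce
    then show ?thesis using z by simp
  qed
  then have geq: "q * g $ i = lam ^ (N - 1) * trace g * u $ i" if "i < N" for i
    using that G_carrier_vec[OF g] by (simp add: \<pi>_def u_def)
  define c where "c = lam ^ (N - 1) * trace g / q"
  have gc: "g = c \<cdot>\<^sub>v u"
  proof (rule eq_vecI)
    fix i assume "i < dim_vec (c \<cdot>\<^sub>v u)"
    then show "g $ i = (c \<cdot>\<^sub>v u) $ i"
      using geq[of i] q0 by (simp add: c_def u_def field_simps)
  qed (use G_carrier_vec[OF g] in \<open>simp add: u_def\<close>)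
  obtain n where n: "\<forall>i<N. ((J ^\<^sub>m n) *\<^sub>v g) $ i \<in> \<int>"
    using g by (auto simp: mem_G_iff)
  have "(J ^\<^sub>m n) *\<^sub>v g = (lam ^ n * c) \<cdot>\<^sub>v u"
    by (simp add: gc mult_mat_vec[of _ N N] J_power_u smult_smult_assoc mult.commute)
  \<comment> \<open>The entry of \<open>u\<close> at index 0 is 1, so this coordinate isolates the
    coefficient.\<close>
  then have "((J ^\<^sub>m n) *\<^sub>v g) $ 0 = lam ^ n * c"
    using N_pos by (simp add: u_0 del: index_mult_mat_vec)
  then have "lam ^ n * c \<in> \<int>" using n[rule_format, OF N_pos] by (simp only:)
  with gc show ?thesis by (rule that)
qed

end

section \<open>Uniqueness of the state\<close>

context integral_eigenvalue
begin

lemma scalar_prod_alpha: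
  assumes "pf_eigenvalue N m = real (m N)" and "g \<in> carrier_vec N"
  shows "scalar_prod (alpha N m) (map_vec real_of_rat g) = real_of_rat (trace g)"
  using assms
  by (simp add: scalar_prod_def alpha_def trace_def of_rat_sum of_rat_divide of_rat_power
      atLeast0LessThan)

text \<open>A power of \<open>J\<close> clears the denominators of the vector, and
  \<open>lam ^ (N - 1)\<close> those of the weights.\<close>

lemma trace_multiple_integral:
  assumes "x \<in> G"
  obtains n where "lam ^ n * trace x \<in> \<int>"
proof -
  obtain n where x: "x \<in> carrier_vec N" and n: "\<forall>i<N. ((J ^\<^sub>m n) *\<^sub>v x) $ i \<in> \<int>"
    using assms by (auto simp: mem_G_iff)
  have "lam ^ (N - 1) * trace ((J ^\<^sub>m n) *\<^sub>v x) \<in> \<int>"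
    by (rule trace_integral[OF n])
  then have "lam ^ (N - 1 + n) * trace x \<in> \<int>"
    by (simp add: trace_J_power_mult x power_add mult.assoc)
  then show ?thesis by (rule that)
qed

text \<open>An element of trace 0 is infinitesimal, so a positive functional kills it; hence the trace is
  the only state of the dimension group.\<close>
lemma state_eq_trace:
  fixes s :: "rat vec \<Rightarrow> rat"
  assumes add: "\<And>x y. x \<in> G \<Longrightarrow> y \<in> G \<Longrightarrow> s (x + y) = s x + s y"
    and pos: "\<And>x. x \<in> G \<Longrightarrow> trace x > 0 \<Longrightarrow> s x \<ge> 0"
    and unit: "s (G_unit N) = 1"
    and x: "x \<in> G"
  shows "s x = trace x"
proof -
  have zero: "0 \<cdot>\<^sub>v y = 0\<^sub>v N" if "y \<in> G" for y :: "rat vec"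
    using G_carrier_vec[OF that] by (intro eq_vecI) simp_all
  have "0\<^sub>v N \<in> G" using smult_mem_G[OF x Ints_0] zero[OF x] by simp
  then have s0: "s (0\<^sub>v N) = 0"
    using add[of "0\<^sub>v N" "0\<^sub>v N"] by simp
  have s_nat: "s (of_nat k \<cdot>\<^sub>v y) = of_nat k * s y" if y: "y \<in> G" for k y
  proof (induction k)
    case 0
    then show ?case using s0 zero[OF y] by simp
  next
    case (Suc k)
    have "of_nat (Suc k) \<cdot>\<^sub>v y = y + of_nat k \<cdot>\<^sub>v y"
      by (simp add: add_smult_distrib_vec)
    then show ?case
      using Suc add[OF y smult_mem_G[OF y, of "of_nat k"]] by (simp add: algebra_simps)
  qed
  have s_int: "s (c \<cdot>\<^sub>v y) = c * s y" if y: "y \<in> G" and c: "c \<in> \<int>" for c y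
  proof -
    obtain z where z: "c = of_int z" using c by (auto elim: Ints_cases)
    show ?thesis
    proof (cases "z \<ge> 0")
      case True
      then show ?thesis using s_nat[OF y, of "nat z"] by (simp add: z)
    next
      case False
      have "c \<cdot>\<^sub>v y + (- c) \<cdot>\<^sub>v y = 0\<^sub>v N"
        using zero[OF y] by (simp flip: add_smult_distrib_vec)
      then have "s (c \<cdot>\<^sub>v y) + s ((- c) \<cdot>\<^sub>v y) = 0"
        using add[OF smult_mem_G smult_mem_G, OF y _ y, of c "- c"] c s0 by simp
      moreover have "s ((- c) \<cdot>\<^sub>v y) = - c * s y"
        using s_nat[OF y, of "nat (- z)"] False by (simp add: z)
      ultimately show ?thesis by simp
    qed
  qed
  have infinitesimal: "s y = 0" if y: "y \<in> G" "trace y = 0" for y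
  proof -
    \<comment> \<open>Adding a multiple of \<open>y\<close> to the unit leaves the trace at 1, hence
      positive, whatever the integer \<open>c\<close>.\<close>
    have ge: "1 + c * s y \<ge> 0" if "c \<in> \<int>" for c
    proof -
      have cy: "c \<cdot>\<^sub>v y \<in> G" using y that by (intro smult_mem_G)
      have "trace (G_unit N + c \<cdot>\<^sub>v y) = 1"
        using y(2) G_carrier_vec[OF y(1)] G_carrier_vec[OF unit_mem_G]
        by (simp add: trace_add trace_smult trace_unit)
      then have "s (G_unit N + c \<cdot>\<^sub>v y) \<ge> 0"
        using pos[OF add_mem_G[OF unit_mem_G cy]] by simp
      then show ?thesis using add[OF unit_mem_G cy] s_int[OF y(1) that] unit by simp
    qed
    show "s y = 0"
    proof (rule ccontr)
      assume ne: "s y \<noteq> 0"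
      \<comment> \<open>Chosen so that \<open>c * s y\<close> is at most -2, which contradicts
        \<open>ge\<close>.\<close>
      define c where "c = of_int \<lceil>2 / \<bar>s y\<bar>\<rceil> * - sgn (s y)"
      have "c \<in> \<int>" by (simp add: c_def sgn_if)
      have "2 / \<bar>s y\<bar> \<le> of_int \<lceil>2 / \<bar>s y\<bar>\<rceil>" by simp
      then have "2 \<le> of_int \<lceil>2 / \<bar>s y\<bar>\<rceil> * \<bar>s y\<bar>"
        using ne by (metis pos_divide_le_eq zero_less_abs_iff)
      also have "\<dots> = - (c * s y)" by (simp add: c_def abs_sgn mult_ac)
      finally show False using ge[OF \<open>c \<in> \<int>\<close>] by simp
    qed
  qed
  obtain n where n: "lam ^ n * trace x \<in> \<int>"
    by (rule trace_multiple_integral[OF x])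
  \<comment> \<open>An integral multiple of the unit cancels the trace of \<open>?y\<close>, so
    \<open>?y + ?e\<close> is infinitesimal.\<close>
  let ?y = "lam ^ n \<cdot>\<^sub>v x" and ?e = "(- (lam ^ n * trace x)) \<cdot>\<^sub>v G_unit N"
  have mem: "?y \<in> G" "?e \<in> G"
    using x n by (auto intro!: smult_mem_G unit_mem_G)
  have "trace (?y + ?e) = 0"
    using G_carrier_vec[OF x] G_carrier_vec[OF unit_mem_G]
    by (simp add: trace_add trace_smult trace_unit)
  then have "s (?y + ?e) = 0" by (intro infinitesimal add_mem_G mem)
  then have "lam ^ n * s x = lam ^ n * trace x"
    using add[OF mem] s_int[OF x, of "lam ^ n"] s_int[OF unit_mem_G, of "- (lam ^ n * trace x)"] n unit
    by simp
  then show ?thesis using lam_pos by simp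
qed

end

text \<open>The comparison of two dimension groups for eigenvalue at least 2; the algebras enter
  only through the map \<open>h\<close>. The constant \<open>c\<close> is the factor in
  \<open>h u = c u'\<close>, read off after taking traces.\<close>

lemma trace_ratio:
  assumes "integral_eigenvalue N m" and "integral_eigenvalue N m'"
    and eq: "m N = m' N" and two: "m N \<ge> 2"
    and closed: "\<And>x. x \<in> carrier (G_group N m) \<Longrightarrow> h x \<in> carrier (G_group N m')"
    and add: "\<And>x y. x \<in> carrier (G_group N m) \<Longrightarrow> y \<in> carrier (G_group N m) \<Longrightarrow> h (x + y) = h x + h y"
    and pos: "\<And>x. x \<in> carrier (G_group N m) \<Longrightarrow> integral_eigenvalue.trace N m x > 0 \<Longrightarrow>
      integral_eigenvalue.trace N m' (h x) \<ge> 0"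
    and unit: "h (G_unit N) = G_unit N"
  obtains c n where "of_nat (m N) ^ n * c \<in> \<int>"
    and "integral_eigenvalue.trace N m (integral_eigenvalue.u N m) =
      c * integral_eigenvalue.trace N m' (integral_eigenvalue.u N m')"
proof -
  interpret A: integral_eigenvalue N m by fact
  interpret B: integral_eigenvalue N m' by fact
  \<comment> \<open>The target trace composed with \<open>h\<close> is a state, so it equals the
    source trace.\<close>
  have tr: "B.trace (h x) = A.trace x" if "x \<in> A.G" for x
    using that
  proof (rule A.state_eq_trace[where s = "\<lambda>x. B.trace (h x)", rotated -1])
    show "B.trace (h (x + y)) = B.trace (h x) + B.trace (h y)" if "x \<in> A.G" "y \<in> A.G" for x y
      using that by (simp add: add B.trace_add B.G_carrier_vec closed)
  qed (simp_all add: pos unit B.trace_unit)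
  have h_nat: "h (of_nat k \<cdot>\<^sub>v x) = of_nat k \<cdot>\<^sub>v h x" if "k > 0" and x: "x \<in> A.G" for k x
    using that(1)
  proof (induction k rule: nat_induct_non_zero)
    case 1
    then show ?case by simp
  next
    case (Suc k)
    have *: "of_nat (Suc k) \<cdot>\<^sub>v y = y + of_nat k \<cdot>\<^sub>v y" for y :: "rat vec"
      by (simp add: add_smult_distrib_vec)
    have "of_nat k \<cdot>\<^sub>v x \<in> A.G" using x by (rule A.smult_mem_G) simp
    then show ?case unfolding * by (simp add: add x Suc)
  qed
  \<comment> \<open>The quotient of \<open>u\<close> by \<open>lam ^ k\<close> is mapped to a
    quotient of its image, because \<open>h\<close> commutes with positive integer
    multiples.\<close>
  have "\<exists>x\<in>B.G. h A.u = B.lam ^ k \<cdot>\<^sub>v x" for k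
  proof
    let ?x = "(1 / A.lam ^ k) \<cdot>\<^sub>v A.u"
    show "h ?x \<in> B.G" by (intro closed A.u_div_mem_G)
    have "A.u = of_nat (m N ^ k) \<cdot>\<^sub>v ?x" using A.lam_pos by (simp add: smult_smult_assoc)
    then have "h A.u = h (of_nat (m N ^ k) \<cdot>\<^sub>v ?x)" by simp
    also have "\<dots> = of_nat (m N ^ k) \<cdot>\<^sub>v h ?x"
      using A.eigenvalue_pos by (intro h_nat A.u_div_mem_G) simp
    also have "\<dots> = B.lam ^ k \<cdot>\<^sub>v h ?x" by (simp add: eq)
    finally show "h A.u = B.lam ^ k \<cdot>\<^sub>v h ?x" .
  qed
  moreover have u: "A.u \<in> A.G" using A.u_div_mem_G[of 0] by simp
  ultimately obtain c n where c: "h A.u = c \<cdot>\<^sub>v B.u" "B.lam ^ n * c \<in> \<int>"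
    using B.multiple_of_u_if_divisible[of "h A.u"] closed eq two by metis
  have "A.trace A.u = c * B.trace B.u"
    using tr[OF u] by (simp add: c(1) B.trace_smult)
  with c(2) show ?thesis using that eq by metis
qed

text \<open>Read from the top, the eigenvector equation reproduces the recursion of
  \<open>right_entry\<close>, and its last row forces \<open>char_eq\<close>. Thus only the value of
  the spectral radius and the existence of \<open>v\<close> enter.\<close>

lemma right_pf_vector_entries:
  assumes sf: "standard_form N m" and v: "is_right_pf_vector N m v"
    and pf: "pf_eigenvalue N m = real (m N)"
  shows "integral_eigenvalue N m" and "v = map_vec real_of_rat (integral_eigenvalue.u N m)"
proof -
  have N: "N > 0" and mN: "m N > 0" using sf by (auto simp: standard_form_def)
  have vc: "v \<in> carrier_vec N" and v0: "v $ 0 = 1"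
    and ev: "std_mat N m *\<^sub>v v = real (m N) \<cdot>\<^sub>v v"
    using v pf by (auto simp: is_right_pf_vector_def)
  have step: "real (m N) * v $ i = real (m (i + 1)) + (if i + 1 < N then v $ (i + 1) else 0)" if "i < N" for i
  proof -
    have "real (m N) * v $ i = (std_mat N m *\<^sub>v v) $ i" using that vc unfolding ev by simp
    then show ?thesis using std_mat_mult_vec_nth[OF vc that, of m] v0 by simp
  qed
  have entry: "v $ i = of_int (right_entry (m N) m i)" if "i < N" for i
    using that
  proof (induction i)
    case (Suc i)
    then show ?case using step[of i] by simp
  qed (simp add: v0)
  \<comment> \<open>Writing \<open>N\<close> as a successor exposes the last recursion step, which
    is the last row of the equation.\<close>
  have "right_entry (m N) m (Suc (N - 1)) = 0"
  proof -
    have "real (m N) * v $ (N - 1) = real (m (Suc (N - 1)))" using step[of "N - 1"] N by simp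
    then have "real_of_int (right_entry (m N) m (Suc (N - 1))) = 0"
      unfolding right_entry.simps using entry[of "N - 1"] N by simp
    then show ?thesis by (simp only: of_int_eq_0_iff)
  qed
  then show ie: "integral_eigenvalue N m"
    using N mN by unfold_locales simp_all
  interpret integral_eigenvalue N m by fact
  show "v = map_vec real_of_rat u"
    using vc by (intro eq_vecI) (auto simp: u_def entry)
qed

text \<open>By \<open>sum_first_column\<close> the coefficients add up to 1, and \<open>m N\<close>
  already accounts for that. So \<open>N\<close> is the only index with nonzero coefficient, and the
  gcd condition reads \<open>N = 1\<close>.\<close>

lemma standard_form_eigenvalue_one:
  assumes "standard_form N m" and "integral_eigenvalue N m" and one: "m N = 1"
  shows "N = 1"
proof -
  interpret integral_eigenvalue N m by fact
  have "(\<Sum>i<N. rat_of_nat (m (i + 1))) = 1"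
    using sum_first_column one by simp
  then have sum: "(\<Sum>i<N. m (i + 1)) = 1"
    by (metis of_nat_1 of_nat_eq_iff of_nat_sum)
  have "{i \<in> {1..N}. m i \<noteq> 0} = {N}"
  proof (intro equalityI subsetI)
    fix i assume "i \<in> {i \<in> {1..N}. m i \<noteq> 0}"
    then have i: "1 \<le> i" "i \<le> N" "m i \<noteq> 0" by auto
    show "i \<in> {N}"
    proof (rule ccontr)
      assume "i \<notin> {N}"
      then have "(\<Sum>j\<in>{i - 1, N - 1}. m (j + 1)) = m i + m N" using i N_pos by auto
      moreover have "(\<Sum>j\<in>{i - 1, N - 1}. m (j + 1)) \<le> (\<Sum>i<N. m (i + 1))"
        using i by (intro sum_mono2) auto
      ultimately show False using sum i one by simp
    qed
  qed (use N_pos one in auto)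
  then show ?thesis using assms(1) by (simp add: standard_form_def)
qed

text \<open>If \<open>l ^ n * c\<close> is the integer \<open>z\<close>, then \<open>c\<close> is
  the value of the monomial \<open>z X^n\<close> at \<open>1 / l\<close>.\<close>

lemma int_adjoin_inverse_memI:
  fixes c :: rat and l :: nat
  assumes "l > 0" and "of_nat l ^ n * c \<in> \<int>"
  shows "real_of_rat c \<in> int_adjoin (1 / real l)"
proof -
  obtain z where z: "of_nat l ^ n * c = of_int z" using assms(2) by (auto elim: Ints_cases)
  have "real l ^ n * real_of_rat c = of_int z"
    using arg_cong[OF z, of real_of_rat] by (simp add: of_rat_mult of_rat_power)
  then have "real_of_rat c = poly (of_int_poly (monom z n)) (1 / real l)"
    using assms(1) by (simp add: map_poly_monom poly_monom field_simps)
  then show ?thesis unfolding int_adjoin_def by blast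
qed


section \<open>The ratio of the traces\<close>

text \<open>The map induced on \<open>K0\<close> is transported along the isomorphisms
  \<open>f\<close> and \<open>g\<close> with the dimension groups.\<close>

lemma dimension_group_hom:
  fixes \<phi> :: "'a::cstar_algebra \<Rightarrow> 'b::cstar_algebra"
  assumes \<phi>: "unital_star_hom \<phi>"
    and "is_AF_algebra_of TYPE('a) N m" and "is_AF_algebra_of TYPE('b) N m'"
  obtains h where "h \<in> hom (G_group N m) (G_group N m')" "h ` G_pos N m \<subseteq> G_pos N m'"
    "h (G_unit N) = G_unit N"
proof -
  have star: "star_hom \<phi>" and one: "\<phi> 1 = 1" using \<phi> by (auto simp: unital_star_hom_def)
  obtain f where f: "f \<in> iso (K0 TYPE('a)) (G_group N m)" "f ` K0_pos TYPE('a) = G_pos N m"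
      "f (K0_unit TYPE('a)) = G_unit N"
    using assms(2) by (auto simp: is_AF_algebra_of_def)
  obtain g where g: "g \<in> iso (K0 TYPE('b)) (G_group N m')" "g ` K0_pos TYPE('b) = G_pos N m'"
      "g (K0_unit TYPE('b)) = G_unit N"
    using assms(3) by (auto simp: is_AF_algebra_of_def)
  define i where "i = inv_into (carrier (K0 TYPE('a))) f"
  define h where "h = g \<circ> (K0_map \<phi> \<circ> i)"
  have f_hom: "f \<in> hom (K0 TYPE('a)) (G_group N m)"
    and f_inj: "inj_on f (carrier (K0 TYPE('a)))"
    and f_surj: "f ` carrier (K0 TYPE('a)) = carrier (G_group N m)"
    using f(1) by (auto simp: iso_def bij_betw_def)
  have i_f: "i (f X) = X" if "X \<in> carrier (K0 TYPE('a))" for X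
    unfolding i_def using f_inj that by (rule inv_into_f_f)
  \<comment> \<open>The inverse of \<open>f\<close> is multiplicative because \<open>f\<close> is,
    and because \<open>K0\<close> is closed under its multiplication.\<close>
  have i_hom: "i \<in> hom (G_group N m) (K0 TYPE('a))"
  proof (rule homI)
    fix x y assume "x \<in> carrier (G_group N m)" "y \<in> carrier (G_group N m)"
    then obtain X Y where XY: "X \<in> carrier (K0 TYPE('a))" "Y \<in> carrier (K0 TYPE('a))"
      and xy: "x = f X" "y = f Y"
      unfolding f_surj[symmetric] by blast
    show "i x \<in> carrier (K0 TYPE('a))" using XY by (simp add: xy i_f)
    have "x \<otimes>\<^bsub>G_group N m\<^esub> y = f (X \<otimes>\<^bsub>K0 TYPE('a)\<^esub> Y)"
      unfolding xy using hom_mult[OF f_hom XY] by (rule sym)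
    then show "i (x \<otimes>\<^bsub>G_group N m\<^esub> y) = i x \<otimes>\<^bsub>K0 TYPE('a)\<^esub> i y"
      using K0_mult_closed[OF XY] XY by (simp add: xy i_f)
  qed
  have pos_carrier: "X \<in> carrier (K0 TYPE('a))" if "X \<in> K0_pos TYPE('a)" for X
    using that by (auto simp: K0_pos_def K0_class_def intro: K0_diff_carrier)
  have h_hom: "h \<in> hom (G_group N m) (G_group N m')"
    unfolding h_def using g(1)
    by (intro hom_compose[OF hom_compose[OF i_hom K0_map_hom[OF star]]]) (simp add: iso_def)
  have h_pos: "h x \<in> G_pos N m'" if x: "x \<in> G_pos N m" for x
  proof -
    obtain X where X: "X \<in> K0_pos TYPE('a)" "x = f X" using x unfolding f(2)[symmetric] by blast
    have "h x = g (K0_map \<phi> X)" by (simp add: h_def X(2) i_f pos_carrier X(1))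
    then show ?thesis using K0_map_pos[OF star X(1)] g(2) by blast
  qed
  have "K0_unit TYPE('a) \<in> carrier (K0 TYPE('a))"
    by (intro pos_carrier) (simp add: K0_pos_def K0_unit_def)
  then have "i (G_unit N) = K0_unit TYPE('a)" unfolding f(3)[symmetric] by (rule i_f)
  then have "h (G_unit N) = G_unit N"
    by (simp add: h_def K0_map_unit[OF star one] g(3))
  with h_hom h_pos show ?thesis using that by blast
qed

theorem corollary11p13:
  fixes N :: nat and m m' :: "nat \<Rightarrow> nat" and v v' :: "real vec"
  assumes "standard_form N m" and "standard_form N m'"
    and "is_right_pf_vector N m v" and "is_right_pf_vector N m' v'"
    and "m N = m' N"
    and "real (m N) = pf_eigenvalue N m"
    and "pf_eigenvalue N m = pf_eigenvalue N m'"
    and "is_AF_algebra_of TYPE('a::cstar_algebra) N m"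
    and "is_AF_algebra_of TYPE('b::cstar_algebra) N m'"
    and "\<exists>\<phi> :: 'a \<Rightarrow> 'b. unital_star_hom \<phi>"
  shows "scalar_prod (alpha N m) v / scalar_prod (alpha N m') v'
    \<in> int_adjoin (1 / pf_eigenvalue N m)"
proof -
  have pf: "pf_eigenvalue N m = real (m N)" "pf_eigenvalue N m' = real (m' N)"
    using assms(5-7) by simp_all
  interpret A: integral_eigenvalue N m
    by (rule right_pf_vector_entries(1)[OF assms(1,3) pf(1)])
  interpret B: integral_eigenvalue N m'
    by (rule right_pf_vector_entries(1)[OF assms(2,4) pf(2)])
  have v: "v = map_vec real_of_rat A.u" "v' = map_vec real_of_rat B.u"
    by (rule right_pf_vector_entries(2)[OF assms(1,3) pf(1)])
      (rule right_pf_vector_entries(2)[OF assms(2,4) pf(2)])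
  have ratio: "scalar_prod (alpha N m) v / scalar_prod (alpha N m') v' =
      real_of_rat (A.trace A.u / B.trace B.u)"
    unfolding v A.scalar_prod_alpha[OF pf(1) A.u_carrier] B.scalar_prod_alpha[OF pf(2) B.u_carrier]
    by (simp add: of_rat_divide)
  obtain c n where c: "of_nat (m N) ^ n * c \<in> \<int>" "A.trace A.u = c * B.trace B.u"
  \<comment> \<open>For eigenvalue 1 divisibility by all powers of the eigenvalue is no condition,
    hence a separate case.\<close>
  proof (cases "m N \<ge> 2")
    case True
    obtain \<phi> :: "'a \<Rightarrow> 'b" where "unital_star_hom \<phi>" using assms(10) by blast
    then obtain h where h: "h \<in> hom (G_group N m) (G_group N m')"
        "h ` G_pos N m \<subseteq> G_pos N m'" "h (G_unit N) = G_unit N"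
      by (rule dimension_group_hom[OF _ assms(8,9)])
    have closed: "h x \<in> B.G" if "x \<in> A.G" for x
      using h(1) that by (rule hom_in_carrier)
    have add: "h (x + y) = h x + h y" if "x \<in> A.G" "y \<in> A.G" for x y
      using hom_mult[OF h(1) that] by (simp add: G_group_def)
    have pos: "B.trace (h x) \<ge> 0" if x: "x \<in> A.G" "A.trace x > 0" for x
    proof -
      have "x \<in> G_pos N m"
        using x A.scalar_prod_alpha[OF pf(1) A.G_carrier_vec[OF x(1)]] by (simp add: G_pos_def)
      then have "h x \<in> G_pos N m'" using h(2) by blast
      \<comment> \<open>The positive cone contains 0, so only a nonnegative trace results, as
        required for a state.\<close>
      then have "h x = 0\<^sub>v N \<or> B.trace (h x) > 0"
        using B.scalar_prod_alpha[OF pf(2) B.G_carrier_vec[OF closed[OF x(1)]]]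
        by (simp add: G_pos_def)
      then show ?thesis by (auto simp: B.trace_def)
    qed
    show ?thesis
      by (rule trace_ratio[OF A.integral_eigenvalue_axioms B.integral_eigenvalue_axioms
          assms(5) True closed add pos h(3)]) (assumption | rule that)+
  next
    case False
    then have "m N = 1" using A.eigenvalue_pos by simp
    then have "N = 1"
      by (rule standard_form_eigenvalue_one[OF assms(1) A.integral_eigenvalue_axioms])
    \<comment> \<open>For \<open>N = 1\<close> both eigenvectors have the single entry 1, so the
      ratio is 1.\<close>
    then have "A.trace A.u = 1" "B.trace B.u = 1"
      unfolding A.trace_def B.trace_def using A.u_0 B.u_0 by simp_all
    then show ?thesis using that[of 0 1] by simp
  qed
  have "A.trace A.u / B.trace B.u = c" using c(2) B.trace_u_pos by simp
  then show ?thesis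
    unfolding ratio pf(1) using int_adjoin_inverse_memI[OF A.eigenvalue_pos c(1)] by simp
qed

end
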